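(* Let $q\in\mathbb{C}$ with $0<|q|<1$. With the series $H_\ell(1)=H_\ell(1;q)$ defined in the context, the following identities hold: \begin{align*} H_4(1) &= (q^3;q^4)_\infty \sum_{n\ge0}\frac{(q^{3};q^6)_n\, q^{n^2}}{(q,q^2;q^2)_{n}\,(q^{3};q^4)_n},\\ H_5(1) &= (q^{-1};q^4)_\infty + (q^3;q^4)_\infty \sum_{n\ge0}\frac{(1+q^{2n-4}+q^{2n-1})\,(q^{-3};q^6)_n\, q^{n^2+4n+3}}{(1-q^{2n+2})\,(q^{-1},q^2;q^2)_{n}\,(q^3;q^4)_n},\\ H_8(1) &= (q;q^4)_\infty + (q^5;q^4)_\infty \sum_{n\ge0}\frac{(1+q^{2n}+q^{2n+1})\,(q^{3};q^6)_n\, q^{n^2+2n+1}}{(1-q^{2n+2})\,(q,q^2;q^2)_{n}\,(q^5;q^4)_n},\\ H_9(1) &= (q^5;q^4)_\infty \sum_{n\ge0}\frac{(q^{3};q^6)_n\, q^{n^2+2n}}{(q,q^2;q^2)_{n}\,(q^{5};q^4)_n}. \end{align*}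
   Context: For $n\in\mathbb{N}_0\cup\{\infty\}$ and $x,q\in\mathbb{C}$ with $|q|<1$, $(x;q)_n:=\prod_{i=0}^{n-1}(1-xq^i)$ and $(x_1,\dots,x_m;q)_n:=(x_1;q)_n\cdots(x_m;q)_n$. For $\ell\in\{4,5,8,9\}$ define $$H_\ell(x;q):=\sum_{i,j,k\ge 0}(-1)^k\frac{q^{(i+2j+3k)(i+2j+3k-1)+3k^2+A_\ell(i,j,k)}}{(q;q)_i(q^4;q^4)_j(q^6;q^6)_k}x^{i+2j+3k},$$ where $A_4(i,j,k)=i+3j+3k$, $A_5(i,j,k)=2i-j+3k$, $A_8(i,j,k)=i+j+3k$, $A_9(i,j,k)=3i+5j+9k$. These series converge absolutely for every $x\in\mathbb{C}$. $H_\ell(1)$ abbreviates $H_\ell(1;q)$, i.e. $x=1$. *)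

theory Defs
  imports "HOL-Analysis.Analysis" "HOL-Library.Extended_Nat"
begin

text \<open>The $q$-shifted factorial $(x;q)_n$ for $n \in \mathbb{N}_0 \cup \{\infty\}$. The library's
  \<^const>\<open>prodinf\<close> has the value 0 when some factors vanish and the remaining ones form a convergent
  product, so it agrees with the limit of the finite products for all $x$ and $|q| < 1$.\<close>

definition qpoch :: "complex \<Rightarrow> complex \<Rightarrow> enat \<Rightarrow> complex" where
  "qpoch x q n =
     (case n of
        enat m \<Rightarrow> (\<Prod>i<m. 1 - x * q ^ i)
      | \<infinity> \<Rightarrow> (\<Prod>i. 1 - x * q ^ i))"

text \<open>$(x_1,\dots,x_m;q)_n = (x_1;q)_n \cdots (x_m;q)_n$\<close>

definition qpochs :: "complex list \<Rightarrow> complex \<Rightarrow> enat \<Rightarrow> complex" where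
  "qpochs xs q n = (\<Prod>x\<leftarrow>xs. qpoch x q n)"

text \<open>The common shape of the series $H_\ell$, with the exponent $A_\ell$ as a parameter. Exponents
  of $q$ are integers, since $A_5$ takes negative values. The sum is the unordered sum over all
  triples, which for complex terms means absolute convergence.\<close>

definition H_series :: "(nat \<Rightarrow> nat \<Rightarrow> nat \<Rightarrow> int) \<Rightarrow> complex \<Rightarrow> complex \<Rightarrow> complex" where
  "H_series A x q =
     (\<Sum>\<^sub>\<infinity>(i, j, k)\<in>(UNIV :: (nat \<times> nat \<times> nat) set).
        (-1) ^ k *
        (q powi ((int i + 2 * int j + 3 * int k) * (int i + 2 * int j + 3 * int k - 1)
                 + 3 * (int k)\<^sup>2 + A i j k)
         / (qpoch q q (enat i) * qpoch (q ^ 4) (q ^ 4) (enat j) * qpoch (q ^ 6) (q ^ 6) (enat k)))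
        * x ^ (i + 2 * j + 3 * k))"

definition H4 :: "complex \<Rightarrow> complex \<Rightarrow> complex" where
  "H4 = H_series (\<lambda>i j k. int i + 3 * int j + 3 * int k)"

definition H5 :: "complex \<Rightarrow> complex \<Rightarrow> complex" where
  "H5 = H_series (\<lambda>i j k. 2 * int i - int j + 3 * int k)"

definition H8 :: "complex \<Rightarrow> complex \<Rightarrow> complex" where
  "H8 = H_series (\<lambda>i j k. int i + int j + 3 * int k)"

definition H9 :: "complex \<Rightarrow> complex \<Rightarrow> complex" where
  "H9 = H_series (\<lambda>i j k. 3 * int i + 5 * int j + 9 * int k)"

end

theory Submission
  imports Defs "HOL-Computational_Algebra.Formal_Power_Series"
begin

text \<open>
  Put \<open>p = q\<^sup>2\<close>. Collecting the terms with \<open>i + 2j + 3k = N\<close>, each \<open>H\<close> is the sum over \<open>N\<close> of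
  \<open>q ^ (N (N - 1))\<close> times the coefficient of \<open>z ^ N\<close> in a quotient
  \<open>F(z) / (e z\<^sup>2; q\<^sup>4)\<^sub>\<infinity>\<close> with
  \<open>F(z) = (a\<^sup>3 t\<^sup>3 z\<^sup>3; p\<^sup>3)\<^sub>\<infinity> / (a z, a t z; p)\<^sub>\<infinity>\<close>. The $q$-Gauss sum, whose numerator parameters are here
  \<open>t\<close> times the two primitive cube roots of unity, gives
  \<open>F(z) = \<Sum>\<^sub>n (t\<^sup>3; p\<^sup>3)\<^sub>n / (t, p; p)\<^sub>n (a z)\<^sup>n (a t\<^sup>2 p\<^sup>n z; p)\<^sub>\<infinity>\<close>. For fixed \<open>n\<close> the remaining double sum is an
  infinite product \<open>(e q ^ (4 n); q\<^sup>4)\<^sub>\<infinity>\<close> if \<open>a t\<^sup>2 = e\<close> and \<open>(e q ^ (4 n + 4); q\<^sup>4)\<^sub>\<infinity>\<close> if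
  \<open>a t\<^sup>2 = e p\<close>. The first case is that of \<open>H\<^sub>4\<close> and \<open>H\<^sub>9\<close>; in the second one, that of \<open>H\<^sub>5\<close> and
  \<open>H\<^sub>8\<close>, the stated form results from
  \<open>(x; q\<^sup>4)\<^sub>\<infinity> = (1 - x) (x q\<^sup>4; q\<^sup>4)\<^sub>\<infinity>\<close> and a shift of the summation index.
\<close>

unbundle no vec_syntax and fps_syntax

section \<open>Finite $q$-shifted factorials\<close>

lemma qpoch_enat: "qpoch x q (enat n) = (\<Prod>i<n. 1 - x * q ^ i)"
  by (simp add: qpoch_def)

lemma qpoch_0 [simp]: "qpoch x q (enat 0) = 1"
  by (simp add: qpoch_enat)

lemma qpoch_Suc: "qpoch x q (enat (Suc n)) = qpoch x q (enat n) * (1 - x * q ^ n)"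
  by (simp add: qpoch_enat)

lemma qpoch_nonzero:
  assumes "\<And>i. x * q ^ i \<noteq> 1"
  shows "qpoch x q (enat n) \<noteq> 0"
  using assms by (simp add: qpoch_enat)

lemma power_neq_1:
  fixes q :: complex
  assumes "norm q < 1" "n > 0"
  shows "q ^ n \<noteq> 1"
  using assms by (metis norm_one norm_power power_less_one_iff norm_ge_zero less_irrefl)

lemma qpoch_self_nonzero:
  assumes "norm q < 1"
  shows "qpoch q q (enat n) \<noteq> 0"
  by (rule qpoch_nonzero) (use power_neq_1[OF assms, of "Suc _"] in simp)

subsection \<open>A cubic case of the $q$-Gauss sum\<close>

text \<open>This is the substitution of \<open>c * z\<close> for \<open>z\<close>, given on
  coefficients. Product formulas such as \<open>(z; q) = (1 - z) (q z; q)\<close> for infinite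
  products become purely formal equations between a series and its dilate.\<close>

definition fps_dilate :: "'a :: comm_ring_1 \<Rightarrow> 'a fps \<Rightarrow> 'a fps" where
  "fps_dilate c f = Abs_fps (\<lambda>n. c ^ n * f $ n)"

lemma fps_dilate_nth [simp]: "fps_dilate c f $ n = c ^ n * f $ n"
  by (simp add: fps_dilate_def)

lemma fps_dilate_mult: "fps_dilate c (f * g) = fps_dilate c f * fps_dilate c g"
proof (rule fps_ext)
  fix n
  have "c ^ n * (f $ i * g $ (n - i)) = c ^ i * f $ i * (c ^ (n - i) * g $ (n - i))" if "i \<in> {0..n}" for i
  proof -
    have "c ^ n = c ^ i * c ^ (n - i)" using that by (simp flip: power_add)
    then show ?thesis by (simp add: algebra_simps)
  qed
  then show "fps_dilate c (f * g) $ n = (fps_dilate c f * fps_dilate c g) $ n"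
    by (simp add: fps_mult_nth sum_distrib_left)
qed

lemma fps_dilate_add: "fps_dilate c (f + g) = fps_dilate c f + fps_dilate c g"
  by (rule fps_ext) (simp add: algebra_simps)

lemma fps_dilate_diff: "fps_dilate c (f - g) = fps_dilate c f - fps_dilate c g"
  by (rule fps_ext) (simp add: algebra_simps)

lemma fps_dilate_dilate: "fps_dilate c (fps_dilate d f) = fps_dilate (c * d) f"
  by (rule fps_ext) (simp add: algebra_simps power_mult_distrib)

lemma fps_dilate_1 [simp]: "fps_dilate c 1 = 1"
  by (rule fps_ext) simp

lemma fps_dilate_const [simp]: "fps_dilate c (fps_const d) = fps_const d"
  by (rule fps_ext) simp

lemma fps_dilate_X: "fps_dilate c fps_X = fps_const c * fps_X"
  by (rule fps_ext) (auto simp: le_Suc_eq)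

text \<open>Complex formal power series form an integral domain, so this permits cancelling such a
  factor from a functional equation.\<close>

lemma one_plus_const_X_nonzero: "1 + fps_const c * fps_X \<noteq> (0 :: 'a :: comm_ring_1 fps)"
proof
  assume "1 + fps_const c * fps_X = (0 :: 'a fps)"
  then have "(1 + fps_const c * fps_X) $ 0 = (0 :: 'a fps) $ 0" by (rule arg_cong)
  then show False by simp
qed

text \<open>The series of \<open>1 / (c z; q)\<^sub>\<infinity>\<close> in \<open>z\<close>, by Euler.\<close>

definition qexp :: "complex \<Rightarrow> complex \<Rightarrow> complex fps" where
  "qexp c q = Abs_fps (\<lambda>n. c ^ n / qpoch q q (enat n))"

lemma qexp_nth [simp]: "qexp c q $ n = c ^ n / qpoch q q (enat n)"
  by (simp add: qexp_def)

text \<open>Formally, replacing \<open>z\<close> by \<open>q z\<close> in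
  \<open>1 / (c z; q)\<close> removes the first factor \<open>1 - c z\<close> of the denominator. On
  coefficients this is the recursion of \<open>qpoch q q\<close>.\<close>

lemma fps_dilate_qexp:
  assumes "norm q < 1"
  shows "fps_dilate q (qexp c q) = (1 - fps_const c * fps_X) * qexp c q"
proof (rule fps_ext)
  fix n
  show "fps_dilate q (qexp c q) $ n = ((1 - fps_const c * fps_X) * qexp c q) $ n"
  proof (cases n)
    case 0
    then show ?thesis by (simp add: algebra_simps)
  next
    case (Suc m)
    have "qpoch q q (enat m) \<noteq> 0" "1 - q * q ^ m \<noteq> 0"
      using qpoch_self_nonzero[OF assms, of m] power_neq_1[OF assms, of "Suc m"] by auto
    then show ?thesis
      unfolding Suc by (simp add: left_diff_distrib mult.assoc qpoch_Suc) (simp add: field_simps)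
  qed
qed

text \<open>The series of \<open>(v\<^sup>3 z\<^sup>3; q\<^sup>6)\<^sub>\<infinity>\<close> in \<open>z\<close>; the quotient of powers of \<open>q\<close> is \<open>q ^ (3 k (k - 1))\<close>.\<close>

definition cubic_fps :: "complex \<Rightarrow> complex \<Rightarrow> complex fps" where
  "cubic_fps v q = Abs_fps (\<lambda>m. if 3 dvd m then let k = m div 3 in
      (-1) ^ k * v ^ (3 * k) * (q ^ (3 * k\<^sup>2) / q ^ (3 * k)) / qpoch (q ^ 6) (q ^ 6) (enat k) else 0)"

lemma cubic_fps_nth_3:
  "cubic_fps v q $ (3 * k) =
     (-1) ^ k * v ^ (3 * k) * (q ^ (3 * k\<^sup>2) / q ^ (3 * k)) / qpoch (q ^ 6) (q ^ 6) (enat k)"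
  by (simp add: cubic_fps_def)

lemma cubic_fps_nth_eq_0: "\<not> 3 dvd m \<Longrightarrow> cubic_fps v q $ m = 0"
  by (simp add: cubic_fps_def)

text \<open>Splitting off the first factor of \<open>(v^3 z^3; q^6)\<close> leaves the product at
  \<open>q^6 z^3\<close>, that is, at \<open>z\<close> dilated by \<open>q^2\<close>. Coefficients
  at multiples of 3 reduce to \<open>3 (l + 1)^2 - 3 (l + 1) = 3 l^2 - 3 l + 6 l\<close> in the
  exponent of \<open>q\<close>.\<close>

lemma cubic_fps_rec:
  assumes "q \<noteq> 0" "norm q < 1"
  shows "cubic_fps v q = (1 - fps_const (v ^ 3) * fps_X ^ 3) * fps_dilate (q\<^sup>2) (cubic_fps v q)"
proof (rule fps_ext)
  fix m
  show "cubic_fps v q $ m = ((1 - fps_const (v ^ 3) * fps_X ^ 3) * fps_dilate (q\<^sup>2) (cubic_fps v q)) $ m"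
  proof (cases "3 dvd m")
    case False
    then have "\<not> 3 dvd m - 3" if "m \<ge> 3"
      using that by (simp add: dvd_minus_self)
    then show ?thesis using False
      by (auto simp add: left_diff_distrib mult.assoc fps_X_power_mult_nth cubic_fps_nth_eq_0)
  next
    case True
    then obtain k where m: "m = 3 * k" by auto
    show ?thesis
    proof (cases k)
      case 0
      then show ?thesis by (simp add: m algebra_simps fps_X_power_mult_nth)
    next
      case (Suc l)
      have m': "m = 3 * l + 3" "m = 3 * Suc l" by (simp_all add: m Suc)
      have n6: "norm (q ^ 6) < 1" using assms by (simp add: norm_power power_less_one_iff)
      have nz: "qpoch (q ^ 6) (q ^ 6) (enat l) \<noteq> 0" "1 - q ^ 6 * (q ^ 6) ^ l \<noteq> 0"
        using qpoch_self_nonzero[OF n6, of l] power_neq_1[OF n6, of "Suc l"] by auto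
      have e: "q ^ (3 * (Suc l)\<^sup>2) / q ^ (3 * Suc l) = q ^ (3 * l\<^sup>2) / q ^ (3 * l) * q ^ (6 * l)"
        using assms by (simp add: field_simps power2_eq_square flip: power_add)
      have d: "(q\<^sup>2) ^ (3 * l) = q ^ (6 * l)" "(q\<^sup>2) ^ m = q ^ (6 * l) * q ^ 6"
        "(q ^ 6) ^ l = q ^ (6 * l)"
        by (simp_all add: m' power_add flip: power_mult)
      have "cubic_fps v q $ m * (1 - (q\<^sup>2) ^ m) = - (v ^ 3) * q ^ (6 * l) * cubic_fps v q $ (3 * l)"
        unfolding d unfolding m'(2) cubic_fps_nth_3 e qpoch_Suc d(3)
        using nz unfolding d(3) by (simp add: divide_simps) (simp add: algebra_simps power3_eq_cube power_add)
      then show ?thesis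
        unfolding d(1)[symmetric]
        by (simp add: left_diff_distrib mult.assoc fps_X_power_mult_nth m'(1)) (simp add: algebra_simps)
    qed
  qed
qed

text \<open>The hypothesis on \<open>u\<close> says that \<open>(u z; q)\<^sub>\<infinity> = (a z, v z; q\<^sup>2)\<^sub>\<infinity>\<close>. The factor \<open>1 - v z\<close> cancels
  against \<open>1 - v\<^sup>3 z\<^sup>3\<close>, which leaves a recurrence with three terms only.\<close>

lemma cubic_quotient_rec:
  assumes q: "q \<noteq> 0" "norm q < 1" and uv: "{u, u * q} = {a, v}"
  defines "F \<equiv> qexp u q * cubic_fps v q"
  shows "(1 + fps_const v * fps_X + fps_const (v\<^sup>2) * fps_X ^ 2) * fps_dilate (q\<^sup>2) F
           = (1 - fps_const a * fps_X) * F"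
proof -
  let ?V = "qexp u q" and ?T = "cubic_fps v q" and ?C = "fps_const :: complex \<Rightarrow> complex fps"
  have V: "fps_dilate (q\<^sup>2) ?V = (1 - ?C a * fps_X) * (1 - ?C v * fps_X) * ?V"
  proof -
    have "fps_dilate (q\<^sup>2) ?V = fps_dilate q (fps_dilate q ?V)"
      by (simp add: fps_dilate_dilate power2_eq_square)
    also have "\<dots> = (1 - ?C (u * q) * fps_X) * (1 - ?C u * fps_X) * ?V"
      by (simp add: fps_dilate_qexp q fps_dilate_mult fps_dilate_diff fps_dilate_X flip: fps_const_mult)
    \<comment> \<open>The set equation \<open>{u, u * q} = {a, v}\<close> leaves open which element
      is \<open>a\<close>; both assignments give the same product of two factors.\<close>
    also have "\<dots> = (1 - ?C a * fps_X) * (1 - ?C v * fps_X) * ?V"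
      using uv by (auto simp: doubleton_eq_iff mult.commute)
    finally show ?thesis .
  qed
  let ?L = "(1 + ?C v * fps_X + ?C (v\<^sup>2) * fps_X ^ 2) * fps_dilate (q\<^sup>2) F"
  let ?v = "?C v"
  have c: "?C (v\<^sup>2) = ?v\<^sup>2" "?C (v ^ 3) = ?v ^ 3" by (simp_all add: fps_const_power)
  have "?L = (1 + ?v * fps_X + ?v\<^sup>2 * fps_X ^ 2) * ((1 - ?v * fps_X) * (1 - ?C a * fps_X) * ?V) * fps_dilate (q\<^sup>2) ?T"
    unfolding F_def fps_dilate_mult V c by (simp only: mult_ac)
  also have "\<dots> = (1 - ?C a * fps_X) * ?V * ((1 - ?v ^ 3 * fps_X ^ 3) * fps_dilate (q\<^sup>2) ?T)"
    by algebra
  also have "\<dots> = (1 - ?C a * fps_X) * F"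
    unfolding F_def c(2)[symmetric] cubic_fps_rec[OF q, symmetric] by (simp only: mult_ac)
  finally show ?thesis .
qed

text \<open>The factor \<open>1 - p ^ Suc n\<close> is nonzero because \<open>norm p < 1\<close>, so
  each value is determined by the two before it. The conditional drops the second predecessor at
  \<open>n = 0\<close>, where \<open>n - 1\<close> would truncate to 0.\<close>

lemma three_term_unique:
  fixes f g :: "nat \<Rightarrow> complex"
  assumes "norm p < 1" "f 0 = g 0"
    and f: "\<And>n. (1 - p ^ Suc n) * f (Suc n) = A n * f n + (if n = 0 then 0 else B n * f (n - 1))"
    and g: "\<And>n. (1 - p ^ Suc n) * g (Suc n) = A n * g n + (if n = 0 then 0 else B n * g (n - 1))"
  shows "f n = g n"
proof (induction n rule: less_induct)
  case (less n)
  show ?case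
  proof (cases n)
    case 0
    then show ?thesis using assms by simp
  next
    case (Suc m)
    have "(1 - p ^ Suc m) * f (Suc m) = (1 - p ^ Suc m) * g (Suc m)"
      unfolding f g using less[of m] less[of "m - 1"] Suc by simp
    moreover have "1 - p ^ Suc m \<noteq> 0"
      using power_neq_1[OF assms(1), of "Suc m"] by simp
    ultimately show ?thesis using Suc by simp
  qed
qed

text \<open>
  Both sides satisfy the same three-term recurrence in \<open>N\<close>. Writing \<open>(N - n) (N - n - 1) + 2 n (N - n)\<close>
  as \<open>N\<^sup>2 - n\<^sup>2 - (N - n)\<close> turns the right-hand side into an ordinary Cauchy product.
\<close>

lemma q_gauss_cubic:
  fixes rho :: "nat \<Rightarrow> complex"
  assumes q: "q \<noteq> 0" "norm q < 1" and uv: "{u, u * q} = {a, v}" and w: "a * w = v\<^sup>2"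
    and rho0: "rho 0 = 1"
    and rho: "\<And>n. rho (Suc n) * (1 - q\<^sup>2 * (q\<^sup>2) ^ n) = rho n * (a + v * (q\<^sup>2) ^ n + w * (q\<^sup>2) ^ (2 * n))"
  shows "(\<Sum>i\<le>N. qexp u q $ i * cubic_fps v q $ (N - i)) =
         q ^ N\<^sup>2 * (\<Sum>n\<le>N. rho n / q ^ n\<^sup>2 * ((- w / q) ^ (N - n) / qpoch (q\<^sup>2) (q\<^sup>2) (enat (N - n))))"
proof -
  let ?C = "fps_const :: complex \<Rightarrow> complex fps" and ?X = "fps_X :: complex fps"
  \<comment> \<open>The left-hand side of the claim is \<open>F $ N\<close>. The right-hand side is
    \<open>q ^ N\<^sup>2\<close> times the coefficient of the product \<open>h = R * E\<close>,
    where \<open>E\<close> carries the powers of \<open>- w / q\<close>.\<close>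
  define p where "p = q\<^sup>2"
  have p: "norm p < 1" "p \<noteq> 0" using q by (simp_all add: p_def norm_power power_less_one_iff)
  define F where "F = qexp u q * cubic_fps v q"
  define R where "R = Abs_fps (\<lambda>n. rho n / q ^ n\<^sup>2)"
  define c where "c = w / q"
  define E where "E = qexp (- c) p"
  define h where "h = R * E"
  have F: "(1 - p ^ Suc n) * F $ Suc n
             = (a + v * p ^ n) * F $ n + (if n = 0 then 0 else v\<^sup>2 * p ^ (n - 1) * F $ (n - 1))" for n
  proof -
    have "((1 + fps_const v * fps_X + fps_const (v\<^sup>2) * fps_X ^ 2) * fps_dilate p F) $ Suc n
           = ((1 - fps_const a * fps_X) * F) $ Suc n"
      unfolding F_def p_def using cubic_quotient_rec[OF q uv] by simp
    then show ?thesis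
      by (cases n) (simp_all add: distrib_right left_diff_distrib mult.assoc fps_X_power_mult_nth,
          simp_all add: algebra_simps)
  qed
  have sq: "q ^ (Suc n)\<^sup>2 = q ^ n\<^sup>2 * q * p ^ n" for n
    by (simp add: p_def power2_eq_square power_add power_mult_distrib algebra_simps)
  \<comment> \<open>The recursion of \<open>rho\<close> as a functional equation. Passing from
    \<open>rho\<close> to \<open>R\<close> produces the factor
    \<open>q * p ^ m = p ^ Suc m / q\<close>, and \<open>p ^ Suc m * (1 - p ^ Suc m)\<close> is the
    difference of the dilations by \<open>p\<close> and \<open>p\<^sup>2\<close>.\<close>
  have R: "?C (1 / q) * (fps_dilate p R - fps_dilate (p\<^sup>2) R)
             = ?X * (?C a * R + ?C v * fps_dilate p R + ?C w * fps_dilate (p\<^sup>2) R)"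
  proof (rule fps_ext)
    fix n
    show "(?C (1 / q) * (fps_dilate p R - fps_dilate (p\<^sup>2) R)) $ n
             = (?X * (?C a * R + ?C v * fps_dilate p R + ?C w * fps_dilate (p\<^sup>2) R)) $ n"
    proof (cases n)
      case (Suc m)
      have pp: "(p\<^sup>2) ^ k = (p ^ k)\<^sup>2" "p ^ (2 * k) = (p ^ k)\<^sup>2" for k
        by (simp_all flip: power_mult add: mult.commute)
      have "R $ Suc m * (q * p ^ m * (1 - p ^ Suc m)) = R $ m * (a + v * p ^ m + w * (p ^ m)\<^sup>2)"
      proof -
        have "R $ Suc m * (q * p ^ m * (1 - p ^ Suc m)) = rho (Suc m) * (1 - p * p ^ m) / q ^ m\<^sup>2"
          using q p by (simp add: R_def sq)
        then show ?thesis
          unfolding rho[of m, folded p_def, unfolded pp] by (simp add: R_def)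
      qed
      moreover have "q * p ^ m = p ^ Suc m / q" using q by (simp add: p_def power2_eq_square)
      ultimately have "R $ Suc m * (p ^ Suc m / q * (1 - p ^ Suc m)) = R $ m * (a + v * p ^ m + w * (p ^ m)\<^sup>2)"
        by simp
      then show ?thesis unfolding Suc by (simp add: pp power2_eq_square algebra_simps diff_divide_distrib)
    qed simp
  qed
  have E: "fps_dilate p E = (1 + ?C c * ?X) * E"
    unfolding E_def using fps_dilate_qexp[OF p(1), of "- c"] by (simp add: algebra_simps flip: fps_const_neg)
  have E2: "fps_dilate (p\<^sup>2) E = (1 + ?C (p * c) * ?X) * (1 + ?C c * ?X) * E"
  proof -
    have "fps_dilate (p\<^sup>2) E = fps_dilate p (fps_dilate p E)"
      by (simp add: fps_dilate_dilate power2_eq_square)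
    also have "\<dots> = (1 + ?C (p * c) * ?X) * (1 + ?C c * ?X) * E"
      by (simp add: E fps_dilate_mult fps_dilate_add fps_dilate_X mult_ac flip: fps_const_mult)
    finally show ?thesis .
  qed
  \<comment> \<open>Multiplying the equation for \<open>R\<close> by the dilate of \<open>E\<close>
    by \<open>p\<^sup>2\<close> expresses every term through \<open>h\<close> and its dilates. Since
    \<open>w = p * c / q\<close>, the term with \<open>w\<close> joins the left side to form the
    common factor \<open>1 + p c X\<close>, which is then cancelled.\<close>
  have "(1 + ?C (p * c) * ?X) * (?C (1 / q) * (fps_dilate p h - fps_dilate (p\<^sup>2) h)) =
        (1 + ?C (p * c) * ?X) * (?X * (?C a * (1 + ?C c * ?X) * h + ?C v * fps_dilate p h))"
  proof -
    have h1: "fps_dilate p R * fps_dilate (p\<^sup>2) E = (1 + ?C (p * c) * ?X) * fps_dilate p h"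
      unfolding h_def fps_dilate_mult E E2 by (simp only: mult_ac)
    have h0: "R * fps_dilate (p\<^sup>2) E = (1 + ?C (p * c) * ?X) * (1 + ?C c * ?X) * h"
      unfolding h_def E2 by (simp only: mult_ac)
    have h2: "fps_dilate (p\<^sup>2) R * fps_dilate (p\<^sup>2) E = fps_dilate (p\<^sup>2) h"
      by (simp add: h_def fps_dilate_mult)
    have k: "?C w = ?C (1 / q) * ?C (p * c)"
      using q by (simp add: c_def p_def power2_eq_square fps_const_mult)
    have "?C (1 / q) * (fps_dilate p R * fps_dilate (p\<^sup>2) E - fps_dilate (p\<^sup>2) R * fps_dilate (p\<^sup>2) E)
             = ?X * (?C a * (R * fps_dilate (p\<^sup>2) E) + ?C v * (fps_dilate p R * fps_dilate (p\<^sup>2) E)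
                 + ?C w * (fps_dilate (p\<^sup>2) R * fps_dilate (p\<^sup>2) E))"
      using arg_cong[OF R, of "\<lambda>f. f * fps_dilate (p\<^sup>2) E"] by (simp only: algebra_simps)
    then show ?thesis
      unfolding h0 h1 h2 k by algebra
  qed
  moreover have "1 + ?C (p * c) * ?X \<noteq> 0" by (rule one_plus_const_X_nonzero)
  ultimately have h: "?C (1 / q) * (fps_dilate p h - fps_dilate (p\<^sup>2) h) =
        ?X * (?C a * (1 + ?C c * ?X) * h + ?C v * fps_dilate p h)"
    by simp
  define g where "g = (\<lambda>n. q ^ n\<^sup>2 * h $ n)"
  have g: "(1 - p ^ Suc n) * g (Suc n)
             = (a + v * p ^ n) * g n + (if n = 0 then 0 else v\<^sup>2 * p ^ (n - 1) * g (n - 1))" for n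
  proof -
    have pp: "(p\<^sup>2) ^ k = (p ^ k)\<^sup>2" for k by (simp flip: power_mult add: mult.commute)
    have *: "1 / q * (p ^ Suc n * (1 - p ^ Suc n) * h $ Suc n)
            = (a + v * p ^ n) * h $ n + (if n = 0 then 0 else a * c * h $ (n - 1))"
      using arg_cong[OF h, of "\<lambda>f. f $ Suc n"]
      by (cases n) (simp_all add: pp power2_eq_square distrib_left distrib_right mult.assoc, simp_all add: algebra_simps)
    have "(1 - p ^ Suc n) * g (Suc n) = q ^ n\<^sup>2 * (1 / q * (p ^ Suc n * (1 - p ^ Suc n) * h $ Suc n))"
      unfolding g_def sq using q by (simp add: p_def power2_eq_square)
    also have "\<dots> = (a + v * p ^ n) * g n + (if n = 0 then 0 else q ^ n\<^sup>2 * a * c * h $ (n - 1))"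
      unfolding * by (simp add: g_def algebra_simps)
    also have "(if n = 0 then 0 else q ^ n\<^sup>2 * a * c * h $ (n - 1)) =
        (if n = 0 then 0 else v\<^sup>2 * p ^ (n - 1) * g (n - 1))"
    proof (cases n)
      case (Suc m)
      \<comment> \<open>This is where \<open>a * w = v\<^sup>2\<close> enters:
        \<open>a * c = v\<^sup>2 / q\<close>.\<close>
      have "q ^ n\<^sup>2 * a * c = q ^ m\<^sup>2 * p ^ m * v\<^sup>2"
        unfolding Suc sq c_def using q w by simp
      then show ?thesis by (simp add: Suc g_def)
    qed simp
    finally show ?thesis .
  qed
  have "F $ N = g N"
    by (rule three_term_unique[OF p(1) _ F g]) (simp add: F_def g_def h_def R_def E_def rho0 cubic_fps_def)
  then show ?thesis
    unfolding F_def g_def h_def by (simp add: fps_mult_nth R_def E_def p_def c_def atLeast0AtMost)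
qed

text \<open>The sums are coefficients of products of \<open>D(z) = (- p z; p\<^sup>2)\<close> with
  \<open>E(z) = 1 / (- z; p)\<close> and with \<open>E(p z)\<close>, all products being infinite.
  Splitting the factors of \<open>E\<close> by parity of the exponent cancels \<open>D\<close>,
  leaving \<open>1 / (- z; p\<^sup>2)\<close> and
  \<open>1 / (- p\<^sup>2 z; p\<^sup>2)\<close>.\<close>

lemma sum_qbinomial_alternating:
  fixes p :: complex
  assumes p: "norm p < 1"
  shows "(\<Sum>j\<le>s. p ^ j\<^sup>2 / qpoch (p\<^sup>2) (p\<^sup>2) (enat j) * ((-1) ^ (s - j) / qpoch p p (enat (s - j))))
           = (-1) ^ s / qpoch (p\<^sup>2) (p\<^sup>2) (enat s)"
    and "(\<Sum>j\<le>s. p ^ j\<^sup>2 / qpoch (p\<^sup>2) (p\<^sup>2) (enat j) * (p ^ (s - j) * ((-1) ^ (s - j) / qpoch p p (enat (s - j)))))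
           = (p\<^sup>2) ^ s * (-1) ^ s / qpoch (p\<^sup>2) (p\<^sup>2) (enat s)"
proof -
  let ?C = "fps_const :: complex \<Rightarrow> complex fps" and ?X = "fps_X :: complex fps"
  have p2: "norm (p\<^sup>2) < 1" using p by (simp add: norm_power power_less_one_iff)
  define D where "D = Abs_fps (\<lambda>j. p ^ j\<^sup>2 / qpoch (p\<^sup>2) (p\<^sup>2) (enat j))"
  define E where "E = qexp (-1) p"
  have D: "D = (1 + ?C p * ?X) * fps_dilate (p\<^sup>2) D"
  proof (rule fps_ext)
    fix n
    show "D $ n = ((1 + ?C p * ?X) * fps_dilate (p\<^sup>2) D) $ n"
    proof (cases n)
      case (Suc m)
      have nz: "qpoch (p\<^sup>2) (p\<^sup>2) (enat m) \<noteq> 0" "1 - p\<^sup>2 * (p\<^sup>2) ^ m \<noteq> 0"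
        using qpoch_self_nonzero[OF p2, of m] power_neq_1[OF p2, of "Suc m"] by auto
      have sq: "p ^ (Suc m)\<^sup>2 = p ^ m\<^sup>2 * p * (p\<^sup>2) ^ m"
        by (simp add: power2_eq_square power_add power_mult_distrib algebra_simps)
      have "D $ Suc m * (1 - p\<^sup>2 * (p\<^sup>2) ^ m) = p * ((p\<^sup>2) ^ m * D $ m)"
        using nz by (simp add: D_def sq qpoch_Suc)
      then show ?thesis
        unfolding Suc by (simp add: distrib_right mult.assoc) (simp add: algebra_simps)
    qed (simp add: algebra_simps)
  qed
  have E: "fps_dilate p E = (1 + ?X) * E"
    unfolding E_def using fps_dilate_qexp[OF p, of "- 1"] by (simp add: algebra_simps flip: fps_const_neg)
  have E2: "fps_dilate (p\<^sup>2) E = (1 + ?C p * ?X) * (1 + ?X) * E"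
  proof -
    have "fps_dilate (p\<^sup>2) E = fps_dilate p (fps_dilate p E)"
      by (simp add: fps_dilate_dilate power2_eq_square)
    also have "\<dots> = (1 + ?C p * ?X) * (1 + ?X) * E"
      by (simp add: E fps_dilate_mult fps_dilate_add fps_dilate_X mult_ac)
    finally show ?thesis .
  qed
  have "(1 + ?C p * ?X) * fps_dilate (p\<^sup>2) (D * E)
      = ((1 + ?C p * ?X) * fps_dilate (p\<^sup>2) D) * fps_dilate (p\<^sup>2) E"
    unfolding fps_dilate_mult by (simp only: mult_ac)
  also have "\<dots> = (1 + ?C p * ?X) * ((1 + ?X) * (D * E))"
    unfolding D[symmetric] E2 by (simp only: mult_ac)
  finally have "(1 + ?C p * ?X) * fps_dilate (p\<^sup>2) (D * E) = (1 + ?C p * ?X) * ((1 + ?X) * (D * E))" .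
  moreover have "1 + ?C p * ?X \<noteq> 0" by (rule one_plus_const_X_nonzero)
  ultimately have Q: "fps_dilate (p\<^sup>2) (D * E) = (1 + ?X) * (D * E)" by simp
  have DE: "(D * E) $ n = (-1) ^ n / qpoch (p\<^sup>2) (p\<^sup>2) (enat n)" for n
  proof (induction n)
    case (Suc n)
    have nz: "qpoch (p\<^sup>2) (p\<^sup>2) (enat n) \<noteq> 0" "1 - p\<^sup>2 * (p\<^sup>2) ^ n \<noteq> 0"
      using qpoch_self_nonzero[OF p2, of n] power_neq_1[OF p2, of "Suc n"] by auto
    have "(p\<^sup>2) ^ Suc n * (D * E) $ Suc n = (D * E) $ Suc n + (D * E) $ n"
      using arg_cong[OF Q, of "\<lambda>f. f $ Suc n"]
      by (simp only: fps_dilate_nth distrib_right fps_add_nth mult_1_left fps_X_mult_nth) simp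
    then have "(D * E) $ Suc n * (1 - p\<^sup>2 * (p\<^sup>2) ^ n) = - ((D * E) $ n)"
      by (simp add: algebra_simps)
    then show ?case unfolding Suc.IH using nz by (simp add: qpoch_Suc field_simps)
  qed (simp add: D_def E_def)
  show "(\<Sum>j\<le>s. p ^ j\<^sup>2 / qpoch (p\<^sup>2) (p\<^sup>2) (enat j) * ((-1) ^ (s - j) / qpoch p p (enat (s - j))))
           = (-1) ^ s / qpoch (p\<^sup>2) (p\<^sup>2) (enat s)"
    using DE[of s] by (simp add: fps_mult_nth D_def E_def atLeast0AtMost)
  \<comment> \<open>Dilating \<open>E\<close> by \<open>p\<close> and dilating \<open>D * E\<close>
    by \<open>p\<^sup>2\<close> both contribute exactly the factor \<open>1 + X\<close>.\<close>
  have "D * fps_dilate p E = fps_dilate (p\<^sup>2) (D * E)" unfolding Q E by (simp only: mult_ac)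
  then have "(D * fps_dilate p E) $ s = (p\<^sup>2) ^ s * (D * E) $ s" by simp
  then show "(\<Sum>j\<le>s. p ^ j\<^sup>2 / qpoch (p\<^sup>2) (p\<^sup>2) (enat j) * (p ^ (s - j) * ((-1) ^ (s - j) / qpoch p p (enat (s - j)))))
           = (p\<^sup>2) ^ s * (-1) ^ s / qpoch (p\<^sup>2) (p\<^sup>2) (enat s)"
    unfolding DE by (simp add: fps_mult_nth D_def E_def atLeast0AtMost)
qed

subsection \<open>Infinite $q$-products\<close>

lemma convergent_prod_qpoch:
  fixes q :: complex
  assumes "norm q < 1"
  shows "convergent_prod (\<lambda>i. 1 - x * q ^ i)"
proof (rule abs_convergent_prod_imp_convergent_prod, rule summable_imp_abs_convergent_prod)
  show "summable (\<lambda>i. norm (1 - x * q ^ i - 1))"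
    using assms by (simp add: norm_mult norm_power summable_mult summable_geometric)
qed

lemma qpoch_LIMSEQ:
  assumes "norm q < 1"
  shows "(\<lambda>n. qpoch x q (enat n)) \<longlonglongrightarrow> qpoch x q \<infinity>"
proof -
  have "(\<lambda>n. qpoch x q (enat (Suc n))) \<longlonglongrightarrow> qpoch x q \<infinity>"
    using convergent_prod_LIMSEQ[OF convergent_prod_qpoch[OF assms, of x]]
    by (simp add: qpoch_def lessThan_Suc_atMost)
  then show ?thesis by (rule LIMSEQ_imp_Suc)
qed

lemma qpoch_add: "qpoch x q (enat (m + n)) = qpoch x q (enat m) * qpoch (x * q ^ m) q (enat n)"
  by (induction n) (simp_all add: qpoch_Suc power_add mult_ac)

lemma qpoch_inf_split:
  assumes "norm q < 1"
  shows "qpoch x q \<infinity> = qpoch x q (enat n) * qpoch (x * q ^ n) q \<infinity>"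
proof (rule LIMSEQ_unique)
  show "(\<lambda>m. qpoch x q (enat (m + n))) \<longlonglongrightarrow> qpoch x q \<infinity>"
    by (rule LIMSEQ_ignore_initial_segment[OF qpoch_LIMSEQ[OF assms]])
  show "(\<lambda>m. qpoch x q (enat (m + n))) \<longlonglongrightarrow> qpoch x q (enat n) * qpoch (x * q ^ n) q \<infinity>"
    unfolding add.commute[of _ n] qpoch_add by (intro tendsto_mult tendsto_const qpoch_LIMSEQ assms)
qed

lemma qpoch_bounded:
  assumes "norm q < 1"
  obtains B where "B > 0" "\<And>n. norm (qpoch x q (enat n)) \<le> B"
  using convergent_imp_Bseq[OF convergentI[OF qpoch_LIMSEQ[OF assms, of x]]]
  by (auto elim: BseqE)

lemma qpoch_inf_nonzero:
  assumes "norm q < 1" "\<And>i. x * q ^ i \<noteq> 1"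
  shows "qpoch x q \<infinity> \<noteq> 0"
  unfolding qpoch_def enat.case using prodinf_nonzero[OF convergent_prod_qpoch[OF assms(1), of x]] assms(2) by auto

text \<open>The limit of the finite products is nonzero, so their reciprocals converge and hence are
  bounded.\<close>

lemma inverse_qpoch_bounded:
  assumes "norm q < 1" and nz: "\<And>i. x * q ^ i \<noteq> 1"
  obtains B where "B > 0" "\<And>n. norm (1 / qpoch x q (enat n)) \<le> B"
proof -
  have "(\<lambda>n. inverse (qpoch x q (enat n))) \<longlonglongrightarrow> inverse (qpoch x q \<infinity>)"
    by (intro tendsto_inverse qpoch_LIMSEQ qpoch_inf_nonzero assms)
  then have "Bseq (\<lambda>n. inverse (qpoch x q (enat n)))"
    by (intro convergent_imp_Bseq convergentI)
  then show ?thesis using that by (auto elim: BseqE simp: inverse_eq_divide)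
qed

lemma inverse_qpoch_self_bounded:
  assumes "norm q < 1"
  obtains B where "B > 0" "\<And>n. norm (1 / qpoch q q (enat n)) \<le> B"
  by (rule inverse_qpoch_bounded[OF assms, of q]) (use power_neq_1[OF assms, of "Suc _"] in auto)

text \<open>The ratio of consecutive terms is \<open>R * r ^ (2 * n + 1)\<close>, which tends to 0;
  quadratic decay in the exponent beats any geometric growth.\<close>

lemma summable_power_times_square_power:
  fixes R r :: real
  assumes "0 \<le> r" "r < 1" "0 \<le> R"
  shows "summable (\<lambda>n. R ^ n * r ^ n\<^sup>2)"
proof -
  have "(\<lambda>n. R * r * (r\<^sup>2) ^ n) \<longlonglongrightarrow> R * r * 0"
    using assms by (intro tendsto_mult tendsto_const LIMSEQ_power_zero) (auto simp: power_less_one_iff abs_square_less_1)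
  then have "\<forall>\<^sub>F n in sequentially. R * r * (r\<^sup>2) ^ n < 1 / 2"
    by (rule order_tendstoD) simp
  then obtain N where N: "\<And>n. n \<ge> N \<Longrightarrow> R * r * (r\<^sup>2) ^ n < 1 / 2"
    by (auto simp: eventually_sequentially)
  show ?thesis
  proof (rule summable_ratio_test)
    fix n assume "n \<ge> N"
    have "R ^ Suc n * r ^ (Suc n)\<^sup>2 = (R * r * (r\<^sup>2) ^ n) * (R ^ n * r ^ n\<^sup>2)"
      by (simp add: power2_eq_square power_add power_mult_distrib algebra_simps)
    also have "\<dots> \<le> 1 / 2 * (R ^ n * r ^ n\<^sup>2)"
      using N[OF \<open>n \<ge> N\<close>] assms by (intro mult_right_mono) auto
    finally show "norm (R ^ Suc n * r ^ (Suc n)\<^sup>2) \<le> 1 / 2 * norm (R ^ n * r ^ n\<^sup>2)"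
      using assms by simp
  qed simp
qed

text \<open>Euler's expansion. The sum \<open>f\<close> satisfies
  \<open>f x = (1 - x) * f (p * x)\<close> with \<open>p = q\<^sup>2\<close>; iterating and using
  continuity at 0 with \<open>f 0 = 1\<close> gives the product. With base \<open>q\<^sup>2\<close>
  the usual exponent \<open>s (s - 1) / 2\<close> becomes the quotient
  \<open>q ^ s\<^sup>2 / q ^ s\<close>, free of halves and of truncated subtraction.\<close>

lemma qpoch_inf_eq_infsum:
  assumes q: "q \<noteq> 0" "norm q < 1"
  shows "(\<Sum>\<^sub>\<infinity>s. (- x) ^ s * (q ^ s\<^sup>2 / q ^ s) / qpoch (q\<^sup>2) (q\<^sup>2) (enat s)) = qpoch x (q\<^sup>2) \<infinity>"
proof -
  define p where "p = q\<^sup>2"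
  have p: "norm p < 1" using q by (simp add: p_def norm_power power_less_one_iff)
  define c where "c = (\<lambda>s. (-1) ^ s * (q ^ s\<^sup>2 / q ^ s) / qpoch p p (enat s))"
  obtain B where B: "B > 0" "\<And>n. norm (1 / qpoch p p (enat n)) \<le> B"
    using inverse_qpoch_self_bounded[OF p] by blast
  have norm_sum: "summable (\<lambda>s. norm (c s * x ^ s))" for x
  proof (rule summable_comparison_test')
    show "summable (\<lambda>n. B * ((norm x / norm q) ^ n * norm q ^ n\<^sup>2))"
      using q by (intro summable_mult summable_power_times_square_power) auto
    fix n
    have "norm (norm (c n * x ^ n)) = norm (1 / qpoch p p (enat n)) * ((norm x / norm q) ^ n * norm q ^ n\<^sup>2)"
      by (simp add: c_def norm_mult norm_divide norm_power power_divide mult_ac)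
    also have "\<dots> \<le> B * ((norm x / norm q) ^ n * norm q ^ n\<^sup>2)"
      by (intro mult_right_mono B) auto
    finally show "norm (norm (c n * x ^ n)) \<le> B * ((norm x / norm q) ^ n * norm q ^ n\<^sup>2)" .
  qed
  define f where "f = (\<lambda>x. \<Sum>s. c s * x ^ s)"
  note sm = summable_norm_cancel[OF norm_sum]
  have c_rec: "c (Suc s) * (1 - p ^ Suc s) = - (p ^ s * c s)" for s
  proof -
    have sq: "q ^ (Suc s)\<^sup>2 / q ^ Suc s = q ^ s\<^sup>2 / q ^ s * p ^ s"
      using q by (simp add: p_def field_simps power2_eq_square power_add power_mult_distrib)
    have "qpoch p p (enat s) \<noteq> 0" "1 - p * p ^ s \<noteq> 0"
      using qpoch_self_nonzero[OF p, of s] power_neq_1[OF p, of "Suc s"] by auto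
    then show ?thesis unfolding c_def sq by (simp add: qpoch_Suc)
  qed
  have f_rec: "f x = (1 - x) * f (p * x)" for x
  proof -
    have "f x - f (p * x) = (\<Sum>s. c s * x ^ s - c s * (p * x) ^ s)"
      unfolding f_def by (rule suminf_diff[OF sm sm])
    also have "\<dots> = (\<Sum>s. c (Suc s) * x ^ Suc s - c (Suc s) * (p * x) ^ Suc s)"
      using suminf_split_initial_segment[OF summable_diff[OF sm[of x] sm[of "p * x"]], of 1]
      by simp
    also have "\<dots> = (\<Sum>s. - x * (c s * (p * x) ^ s))"
    proof (rule suminf_cong)
      fix s
      have "c (Suc s) * x ^ Suc s - c (Suc s) * (p * x) ^ Suc s = c (Suc s) * (1 - p ^ Suc s) * x ^ Suc s"
        by (simp add: algebra_simps power_mult_distrib)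
      then show "c (Suc s) * x ^ Suc s - c (Suc s) * (p * x) ^ Suc s = - x * (c s * (p * x) ^ s)"
        unfolding c_rec by (simp add: power_mult_distrib)
    qed
    also have "\<dots> = - x * f (p * x)" unfolding f_def by (rule suminf_mult[OF sm])
    finally show ?thesis by (simp add: algebra_simps)
  qed
  have f_n: "f x = qpoch x p (enat n) * f (p ^ n * x)" for n
  proof (induction n)
    case (Suc n)
    then show ?case using f_rec[of "p ^ n * x"] by (simp add: qpoch_Suc mult_ac)
  qed simp
  have "(\<lambda>n. qpoch x p (enat n) * f (p ^ n * x)) \<longlonglongrightarrow> qpoch x p \<infinity> * f 0"
  proof (intro tendsto_mult qpoch_LIMSEQ p)
    have "(\<lambda>n. p ^ n * x) \<longlonglongrightarrow> 0 * x"
      by (intro tendsto_mult LIMSEQ_power_zero p tendsto_const)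
    moreover have "isCont f 0" unfolding f_def by (rule isCont_powser_converges_everywhere[OF sm])
    ultimately show "(\<lambda>n. f (p ^ n * x)) \<longlonglongrightarrow> f 0" by (intro isCont_tendsto_compose[of _ f]) auto
  qed
  then have "f x = qpoch x p \<infinity> * f 0"
    unfolding f_n[symmetric] by (simp add: LIMSEQ_const_iff)
  moreover have "f 0 = 1" unfolding f_def using powser_zero[of c] by (simp add: c_def)
  ultimately have fx: "f x = qpoch x p \<infinity>" by simp
  have eq: "(\<lambda>s. (- x) ^ s * (q ^ s\<^sup>2 / q ^ s) / qpoch (q\<^sup>2) (q\<^sup>2) (enat s)) = (\<lambda>s. c s * x ^ s)"
    by (rule ext) (simp add: c_def p_def power_minus[of x])
  have "((\<lambda>s. c s * x ^ s) has_sum f x) UNIV"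
    unfolding f_def by (intro norm_summable_imp_has_sum norm_sum summable_sums sm)
  then show ?thesis unfolding eq fx p_def by (rule infsumI)
qed

subsection \<open>Gaussian triple sums\<close>

text \<open>The bijection from \<open>(x, y, z)\<close> to \<open>((x, y + z), y)\<close> turns the
  triple sum into a sum over pairs with finite fibres, to which the Fubini theorem for summable
  families applies.\<close>

lemma antidiagonal_regroup:
  fixes f :: "'a \<times> nat \<times> nat \<Rightarrow> 'b :: banach"
  assumes "f summable_on UNIV"
  shows "(\<lambda>(x, N). \<Sum>y\<le>N. f (x, y, N - y)) summable_on UNIV"
    and "infsum f UNIV = (\<Sum>\<^sub>\<infinity>(x, N). \<Sum>y\<le>N. f (x, y, N - y))"
proof -
  let ?B = "\<lambda>(x :: 'a, N :: nat). {..N}"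
  let ?g = "\<lambda>((x, N), y). f (x, y, N - y)"
  have *: "f summable_on UNIV \<longleftrightarrow> ?g summable_on Sigma UNIV ?B"
    by (rule summable_on_reindex_bij_witness[of _ "\<lambda>((x, N), y). (x, y, N - y)" "\<lambda>(x, y, z). ((x, y + z), y)"]) auto
  have **: "infsum f UNIV = infsum ?g (Sigma UNIV ?B)"
    by (rule infsum_reindex_bij_witness[of _ "\<lambda>((x, N), y). (x, y, N - y)" "\<lambda>(x, y, z). ((x, y + z), y)"]) auto
  have g: "?g summable_on Sigma UNIV ?B" using assms * by simp
  have inner: "(\<Sum>\<^sub>\<infinity>y\<in>?B z. ?g (z, y)) = (case z of (x, N) \<Rightarrow> \<Sum>y\<le>N. f (x, y, N - y))" for z
    by (cases z) simp
  show "(\<lambda>(x, N). \<Sum>y\<le>N. f (x, y, N - y)) summable_on UNIV"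
    using summable_on_Sigma_banach[of "\<lambda>z y. ?g (z, y)" UNIV ?B] g unfolding inner by simp
  show "infsum f UNIV = (\<Sum>\<^sub>\<infinity>(x, N). \<Sum>y\<le>N. f (x, y, N - y))"
    unfolding ** using infsum_Sigma_banach[OF g] unfolding inner by simp
qed

lemma summable_on_times_nonneg:
  fixes a :: "'a \<Rightarrow> real" and b :: "'b \<Rightarrow> real"
  assumes "a summable_on UNIV" "b summable_on UNIV" "\<And>x. a x \<ge> 0" "\<And>y. b y \<ge> 0"
  shows "(\<lambda>(x, y). a x * b y) summable_on UNIV"
proof -
  have "(\<lambda>(x, y). a x * b y) summable_on Sigma UNIV (\<lambda>_. UNIV)"
  proof (rule summable_on_SigmaI[where g = "\<lambda>x. a x * infsum b UNIV"])
    show "((\<lambda>y. case (x, y) of (x, y) \<Rightarrow> a x * b y) has_sum a x * infsum b UNIV) UNIV" for x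
      using has_sum_cmult_right[OF has_sum_infsum[OF assms(2)], of "a x"] by simp
  qed (use assms in \<open>auto intro: summable_on_cmult_left\<close>)
  then show ?thesis by simp
qed

text \<open>Since \<open>(2 * j + x + y)\<^sup>2\<close> is at least
  \<open>j\<^sup>2 + x\<^sup>2 + y\<^sup>2\<close>, the bound is dominated by a product of three
  single series with quadratic exponents.\<close>

lemma gaussian_triple_summable:
  fixes f :: "nat \<times> nat \<times> nat \<Rightarrow> complex"
  assumes r: "0 \<le> r" "r < 1" and nonneg: "0 \<le> A" "0 \<le> B" "0 \<le> D" "0 \<le> C"
    and le: "\<And>j x y. norm (f (j, x, y)) \<le> C * (r ^ (2 * j + x + y)\<^sup>2 * (A ^ j * B ^ x * D ^ y))"
  shows "f summable_on UNIV"
proof -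
  have sm: "(\<lambda>n. R ^ n * r ^ n\<^sup>2) summable_on UNIV" if "0 \<le> R" for R
    using summable_power_times_square_power[OF r that] that r
    by (intro norm_summable_imp_summable_on) simp
  let ?g = "\<lambda>(j, x, y). C * ((A ^ j * r ^ j\<^sup>2) * ((B ^ x * r ^ x\<^sup>2) * (D ^ y * r ^ y\<^sup>2)))"
  have "?g = (\<lambda>z. C * (case z of (j, z') \<Rightarrow> (A ^ j * r ^ j\<^sup>2) * (case z' of (x, y) \<Rightarrow> (B ^ x * r ^ x\<^sup>2) * (D ^ y * r ^ y\<^sup>2))))"
    by auto
  then have g: "?g summable_on UNIV"
    using r nonneg by (auto intro!: summable_on_cmult_right summable_on_times_nonneg sm split: prod.splits)
  have "norm (f z) \<le> ?g z" for z
  proof -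
    obtain j x y where z: "z = (j, x, y)" by (cases z) auto
    have "r ^ (2 * j + x + y)\<^sup>2 \<le> r ^ (j\<^sup>2 + x\<^sup>2 + y\<^sup>2)"
      using r by (intro power_decreasing) (auto simp: power2_eq_square algebra_simps)
    then have "C * (r ^ (2 * j + x + y)\<^sup>2 * (A ^ j * B ^ x * D ^ y)) \<le> C * (r ^ (j\<^sup>2 + x\<^sup>2 + y\<^sup>2) * (A ^ j * B ^ x * D ^ y))"
      using nonneg by (intro mult_left_mono mult_right_mono) auto
    also have "\<dots> = ?g z" by (simp add: z power_add)
    finally show ?thesis using le[of j x y] by (simp add: z)
  qed
  then have "(\<lambda>z. norm (f z)) summable_on UNIV" by (intro Infinite_Sum.abs_summable_on_comparison_test'[OF g])
  then show ?thesis by (rule abs_summable_summable)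
qed

text \<open>A geometric bound is enough for the triple sums, whose weight supplies the quadratic
  decay; the factor \<open>q ^ (3 * k\<^sup>2)\<close> is simply bounded by 1.\<close>

lemma cubic_fps_le:
  assumes q: "q \<noteq> 0" "norm q < 1"
  obtains B where "B > 0" "\<And>m. norm (cubic_fps v q $ m) \<le> B * (norm v / norm q) ^ m"
proof -
  have q6: "norm (q ^ 6) < 1" using q by (simp add: norm_power power_less_one_iff)
  obtain B where B: "B > 0" "\<And>n. norm (1 / qpoch (q ^ 6) (q ^ 6) (enat n)) \<le> B"
    using inverse_qpoch_self_bounded[OF q6] by blast
  have "norm (cubic_fps v q $ m) \<le> B * (norm v / norm q) ^ m" for m
  proof (cases "3 dvd m")
    case False
    then show ?thesis using B by (simp add: cubic_fps_nth_eq_0)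
  next
    case True
    then obtain k where m: "m = 3 * k" by auto
    have "norm (cubic_fps v q $ m) = norm (1 / qpoch (q ^ 6) (q ^ 6) (enat k)) * (norm q ^ (3 * k\<^sup>2) * (norm v / norm q) ^ m)"
      unfolding m cubic_fps_nth_3 by (simp add: norm_mult norm_divide norm_power power_divide mult_ac)
    also have "\<dots> \<le> B * (1 * (norm v / norm q) ^ m)"
      using q B by (intro mult_mono mult_right_mono B power_le_one) auto
    finally show ?thesis by simp
  qed
  with B(1) show ?thesis by (rule that)
qed

text \<open>For fixed \<open>j\<close>, the cubic $q$-Gauss sum replaces the sum over
  \<open>i + m = N\<close> by one over \<open>n + k = N\<close>. For fixed \<open>n\<close>, the sum
  over \<open>j + k = s\<close> is then evaluated by \<open>sum_qbinomial_alternating\<close>, and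
  Euler's expansion sums over \<open>s\<close>. The geometric bound on \<open>rho\<close> makes both
  triple families absolutely summable, which justifies the rearrangements.\<close>

lemma cubic_series_transform:
  fixes q u a v w e :: complex and rho :: "nat \<Rightarrow> complex" and \<sigma> :: nat
  assumes q: "q \<noteq> 0" "norm q < 1" and uv: "{u, u * q} = {a, v}" and w: "a * w = v\<^sup>2"
    and we: "w = e * (q\<^sup>2) ^ \<sigma>" and \<sigma>: "\<sigma> \<le> 1"
    and rho0: "rho 0 = 1"
    and rho: "\<And>n. rho (Suc n) * (1 - q\<^sup>2 * (q\<^sup>2) ^ n) = rho n * (a + v * (q\<^sup>2) ^ n + w * (q\<^sup>2) ^ (2 * n))"
    and rho_le: "C \<ge> 0" "A \<ge> 0" "\<And>n. norm (rho n) \<le> C * A ^ n"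
  defines "T \<equiv> \<lambda>n. rho n * (q ^ n\<^sup>2 / q ^ n) * qpoch (e * (q ^ 4) ^ n * (q ^ 4) ^ \<sigma>) (q ^ 4) \<infinity>"
  shows "T summable_on UNIV"
    and "(\<Sum>\<^sub>\<infinity>(j, i, m). q ^ (2 * j + i + m)\<^sup>2 / q ^ (2 * j + i + m) *
            (e ^ j / qpoch (q ^ 4) (q ^ 4) (enat j)) * (qexp u q $ i * cubic_fps v q $ m)) = infsum T UNIV"
proof -
  define p where "p = q\<^sup>2"
  have p: "norm p < 1" "p \<noteq> 0" and q4: "norm (q ^ 4) < 1"
    using q by (simp_all add: p_def norm_power power_less_one_iff)
  have p2: "p\<^sup>2 = q ^ 4" by (simp add: p_def flip: power_mult)
  define r where "r = norm q"
  have r: "0 < r" "r < 1" using q by (simp_all add: r_def)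
  define W where "W = (\<lambda>N. q ^ N\<^sup>2 / q ^ N)"
  define K where "K = (\<lambda>j. e ^ j / qpoch (q ^ 4) (q ^ 4) (enat j))"
  define f where "f = (\<lambda>(j, i, m). W (2 * j + i + m) * K j * (qexp u q $ i * cubic_fps v q $ m))"
  define g where "g = (\<lambda>(j, n, k). W (2 * j + n + k) * K j *
      (q ^ (n + k)\<^sup>2 * (rho n / q ^ n\<^sup>2 * ((- w / q) ^ k / qpoch p p (enat k)))))"
  obtain B1 where B1: "B1 > 0" "\<And>n. norm (1 / qpoch q q (enat n)) \<le> B1"
    using inverse_qpoch_self_bounded[OF q(2)] by blast
  obtain B2 where B2: "B2 > 0" "\<And>n. norm (1 / qpoch p p (enat n)) \<le> B2"
    using inverse_qpoch_self_bounded[OF p(1)] by blast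
  obtain B4 where B4: "B4 > 0" "\<And>n. norm (1 / qpoch (q ^ 4) (q ^ 4) (enat n)) \<le> B4"
    using inverse_qpoch_self_bounded[OF q4] by blast
  obtain B6 where B6: "B6 > 0" "\<And>m. norm (cubic_fps v q $ m) \<le> B6 * (norm v / r) ^ m"
    using cubic_fps_le[OF q, of v] unfolding r_def by blast
  have W_norm: "norm (W (2 * j + x + y)) = r ^ (2 * j + x + y)\<^sup>2 * ((1 / r\<^sup>2) ^ j * (1 / r) ^ x * (1 / r) ^ y)" for j x y
    by (simp add: W_def r_def norm_divide norm_power norm_mult power_add power_mult power_divide)
  have K_le: "norm (K j) \<le> B4 * norm e ^ j" for j
  proof -
    have "norm (K j) = norm (1 / qpoch (q ^ 4) (q ^ 4) (enat j)) * norm e ^ j"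
      by (simp add: K_def norm_divide norm_power)
    also have "\<dots> \<le> B4 * norm e ^ j" by (intro mult_right_mono B4) simp
    finally show ?thesis .
  qed
  have V_le: "norm (qexp u q $ i) \<le> B1 * norm u ^ i" for i
  proof -
    have "norm (qexp u q $ i) = norm (1 / qpoch q q (enat i)) * norm u ^ i"
      by (simp add: norm_divide norm_power)
    also have "\<dots> \<le> B1 * norm u ^ i" by (intro mult_right_mono B1) simp
    finally show ?thesis .
  qed
  have f_sum: "f summable_on UNIV"
  proof (rule gaussian_triple_summable)
    fix j x y
    have "norm (f (j, x, y)) \<le> norm (W (2 * j + x + y)) * (B4 * norm e ^ j) * ((B1 * norm u ^ x) * (B6 * (norm v / r) ^ y))"
      unfolding f_def case_prod_conv norm_mult
      using B1 B4 B6 r by (intro mult_mono mult_left_mono K_le V_le) auto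
    also have "\<dots> = B4 * B1 * B6 * (r ^ (2 * j + x + y)\<^sup>2 *
        ((norm e / r\<^sup>2) ^ j * (norm u / r) ^ x * (norm v / r / r) ^ y))"
      unfolding W_norm by (simp add: power_divide power_mult_distrib mult_ac)
    finally show "norm (f (j, x, y)) \<le> B4 * B1 * B6 * (r ^ (2 * j + x + y)\<^sup>2 *
        ((norm e / r\<^sup>2) ^ j * (norm u / r) ^ x * (norm v / r / r) ^ y))" .
  qed (use r B1 B4 B6 in auto)
  have g_sum: "g summable_on UNIV"
  proof (rule gaussian_triple_summable)
    fix j n k
    have "norm (q ^ (n + k)\<^sup>2 * (rho n / q ^ n\<^sup>2 * ((- w / q) ^ k / qpoch p p (enat k))))
        = (r ^ (n + k)\<^sup>2 / r ^ n\<^sup>2) * (norm (rho n) * ((norm w / r) ^ k * norm (1 / qpoch p p (enat k))))"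
      by (simp add: r_def norm_mult norm_divide norm_power)
    also have "\<dots> \<le> 1 * ((C * A ^ n) * ((norm w / r) ^ k * B2))"
    proof -
      \<comment> \<open>The powers of \<open>q\<close> from the $q$-Gauss sum are only bounded by 1
        here; the weight \<open>W\<close> alone gives the decay.\<close>
      have "r ^ (n + k)\<^sup>2 \<le> r ^ n\<^sup>2" using r by (intro power_decreasing) auto
      then have "r ^ (n + k)\<^sup>2 / r ^ n\<^sup>2 \<le> 1" using r by simp
      then show ?thesis using r B2 rho_le by (intro mult_mono mult_left_mono) auto
    qed
    finally have *: "norm (q ^ (n + k)\<^sup>2 * (rho n / q ^ n\<^sup>2 * ((- w / q) ^ k / qpoch p p (enat k))))
        \<le> (C * A ^ n) * ((norm w / r) ^ k * B2)" by simp
    have "norm (g (j, n, k)) = norm (W (2 * j + n + k)) * norm (K j) *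
        norm (q ^ (n + k)\<^sup>2 * (rho n / q ^ n\<^sup>2 * ((- w / q) ^ k / qpoch p p (enat k))))"
      unfolding g_def case_prod_conv by (simp only: norm_mult)
    also have "\<dots> \<le> norm (W (2 * j + n + k)) * (B4 * norm e ^ j) * ((C * A ^ n) * ((norm w / r) ^ k * B2))"
      using B4 B2 r rho_le by (intro mult_mono mult_left_mono K_le *) auto
    also have "\<dots> = B4 * C * B2 * (r ^ (2 * j + n + k)\<^sup>2 *
        ((norm e / r\<^sup>2) ^ j * (A / r) ^ n * (norm w / r / r) ^ k))"
      unfolding W_norm by (simp add: power_divide power_mult_distrib mult_ac)
    finally show "norm (g (j, n, k)) \<le> B4 * C * B2 * (r ^ (2 * j + n + k)\<^sup>2 *
        ((norm e / r\<^sup>2) ^ j * (A / r) ^ n * (norm w / r / r) ^ k))" .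
  qed (use r B2 B4 rho_le in auto)
  have "infsum f UNIV = infsum g UNIV"
  proof -
    have "(\<Sum>y\<le>N. f (j, y, N - y)) = (\<Sum>y\<le>N. g (j, y, N - y))" for j N
    proof -
      have "(\<Sum>y\<le>N. f (j, y, N - y)) = W (2 * j + N) * K j * (\<Sum>i\<le>N. qexp u q $ i * cubic_fps v q $ (N - i))"
        unfolding sum_distrib_left by (intro sum.cong) (auto simp: f_def)
      also have "\<dots> = W (2 * j + N) * K j *
          (q ^ N\<^sup>2 * (\<Sum>n\<le>N. rho n / q ^ n\<^sup>2 * ((- w / q) ^ (N - n) / qpoch p p (enat (N - n)))))"
        unfolding q_gauss_cubic[OF q uv w rho0 rho] p_def ..
      also have "\<dots> = (\<Sum>y\<le>N. g (j, y, N - y))"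
        unfolding sum_distrib_left by (intro sum.cong) (auto simp: g_def)
      finally show ?thesis .
    qed
    then show ?thesis
      unfolding antidiagonal_regroup(2)[OF f_sum] antidiagonal_regroup(2)[OF g_sum] by simp
  qed
  \<comment> \<open>Moving \<open>n\<close> to the front lets \<open>antidiagonal_regroup\<close>
    act on the pair \<open>(j, k)\<close>.\<close>
  moreover define h where "h = (\<lambda>(n, j, k). g (j, n, k))"
  have h_sum: "h summable_on UNIV"
    using g_sum summable_on_reindex_bij_witness[of UNIV "\<lambda>(n, j, k). (j, n, k)" "\<lambda>(j, n, k). (n, j, k)" UNIV h g]
    by (auto simp: h_def)
  have gh: "infsum g UNIV = infsum h UNIV"
    by (rule infsum_reindex_bij_witness[of _ "\<lambda>(n, j, k). (j, n, k)" "\<lambda>(j, n, k). (n, j, k)"]) (auto simp: h_def)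
  have hnjk: "h (n, j, k) = rho n * W n * ((e * (q ^ 4) ^ n) ^ (j + k) * (p ^ (j + k)\<^sup>2 / p ^ (j + k)))
     * (p ^ j\<^sup>2 / qpoch (p\<^sup>2) (p\<^sup>2) (enat j) * ((p ^ \<sigma>) ^ k * ((-1) ^ k / qpoch p p (enat k))))" for n j k
  proof -
    \<comment> \<open>The exponents satisfy \<open>(2 j + n + k)^2 + (n + k)^2 = 2 n^2 + 4 n (j + k)
      + 2 (j + k)^2 + 2 j^2\<close>, so apart from \<open>j^2\<close> they depend on
      \<open>j\<close> and \<open>k\<close> only through \<open>j + k\<close>.\<close>
    have key: "q ^ (2 * j + n + k)\<^sup>2 * q ^ (n + k)\<^sup>2 =
        q ^ n\<^sup>2 * q ^ n\<^sup>2 * ((q ^ 4) ^ n) ^ (j + k) * p ^ (j + k)\<^sup>2 * p ^ j\<^sup>2"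
      by (simp add: p_def flip: power_mult power_add) (simp add: power2_eq_square algebra_simps)
    have den: "q ^ (2 * j + n + k) * q ^ k = q ^ n * p ^ (j + k)"
      by (simp add: p_def flip: power_mult power_add) (simp add: algebra_simps)
    have wk: "(- w / q) ^ k = (-1) ^ k * e ^ k * (p ^ \<sigma>) ^ k / q ^ k"
    proof -
      have "- w / q = (-1) * e * p ^ \<sigma> / q" by (simp add: we p_def)
      then show ?thesis by (simp only: power_divide power_mult_distrib)
    qed
    have "h (n, j, k) = (q ^ (2 * j + n + k)\<^sup>2 * q ^ (n + k)\<^sup>2) / (q ^ (2 * j + n + k) * q ^ k) * (e ^ j * e ^ k) *
       (rho n / q ^ n\<^sup>2) / qpoch (q ^ 4) (q ^ 4) (enat j) * ((p ^ \<sigma>) ^ k * ((-1) ^ k / qpoch p p (enat k)))"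
      unfolding h_def g_def case_prod_conv wk W_def K_def by (simp add: mult_ac)
    also have "\<dots> = rho n * W n * ((e * (q ^ 4) ^ n) ^ (j + k) * (p ^ (j + k)\<^sup>2 / p ^ (j + k)))
     * (p ^ j\<^sup>2 / qpoch (p\<^sup>2) (p\<^sup>2) (enat j) * ((p ^ \<sigma>) ^ k * ((-1) ^ k / qpoch p p (enat k))))"
      unfolding key den p2 W_def power_add[of e j k, symmetric] using q by (simp add: power_mult_distrib mult_ac)
    finally show ?thesis .
  qed
  define x where "x = (\<lambda>n. e * (q ^ 4) ^ n * (q ^ 4) ^ \<sigma>)"
  have inner: "(\<Sum>j\<le>s. h (n, j, s - j)) =
      rho n * W n * ((- x n) ^ s * (p ^ s\<^sup>2 / p ^ s) / qpoch (p\<^sup>2) (p\<^sup>2) (enat s))" for n s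
  proof -
    have "(\<Sum>j\<le>s. h (n, j, s - j)) = rho n * W n * ((e * (q ^ 4) ^ n) ^ s * (p ^ s\<^sup>2 / p ^ s)) *
       (\<Sum>j\<le>s. p ^ j\<^sup>2 / qpoch (p\<^sup>2) (p\<^sup>2) (enat j) * ((p ^ \<sigma>) ^ (s - j) * ((-1) ^ (s - j) / qpoch p p (enat (s - j)))))"
      unfolding sum_distrib_left hnjk by (intro sum.cong) auto
    also have "(\<Sum>j\<le>s. p ^ j\<^sup>2 / qpoch (p\<^sup>2) (p\<^sup>2) (enat j) * ((p ^ \<sigma>) ^ (s - j) * ((-1) ^ (s - j) / qpoch p p (enat (s - j)))))
       = ((p\<^sup>2) ^ \<sigma>) ^ s * (-1) ^ s / qpoch (p\<^sup>2) (p\<^sup>2) (enat s)"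
    proof -
      \<comment> \<open>The two values of \<open>\<sigma>\<close> correspond to the two sums in
        \<open>sum_qbinomial_alternating\<close>.\<close>
      have "\<sigma> = 0 \<or> \<sigma> = 1" using \<sigma> by auto
      then show ?thesis using sum_qbinomial_alternating[OF p(1), of s] by auto
    qed
    finally show ?thesis
      by (simp add: x_def p2 power_mult_distrib power_minus[of "e * _"] power_minus[of "e * _ * _"] mult_ac)
  qed
  have T: "(\<Sum>\<^sub>\<infinity>s. rho n * W n * ((- x n) ^ s * (p ^ s\<^sup>2 / p ^ s) / qpoch (p\<^sup>2) (p\<^sup>2) (enat s))) = T n" for n
    unfolding infsum_cmult_right' qpoch_inf_eq_infsum[OF p(2,1)]
    by (simp add: T_def x_def p2 W_def)
  have pairs: "(\<lambda>(n, s). rho n * W n * ((- x n) ^ s * (p ^ s\<^sup>2 / p ^ s) / qpoch (p\<^sup>2) (p\<^sup>2) (enat s))) summable_on UNIV \<times> UNIV"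
    using antidiagonal_regroup(1)[OF h_sum] unfolding inner by simp
  show "T summable_on UNIV"
    using summable_on_Sigma_banach[OF pairs] unfolding T .
  have "infsum h UNIV = infsum T UNIV"
    using infsum_Sigma'_banach[OF pairs] unfolding T antidiagonal_regroup(2)[OF h_sum] inner by simp
  then show "(\<Sum>\<^sub>\<infinity>(j, i, m). q ^ (2 * j + i + m)\<^sup>2 / q ^ (2 * j + i + m) *
            (e ^ j / qpoch (q ^ 4) (q ^ 4) (enat j)) * (qexp u q $ i * cubic_fps v q $ m)) = infsum T UNIV"
    using calculation gh by (simp add: f_def W_def K_def)
qed

text \<open>The index \<open>k\<close> becomes \<open>m = 3 * k\<close>; the remaining
  \<open>m\<close> contribute nothing, as \<open>cubic_fps\<close> vanishes there. The division by
  \<open>q ^ 3\<close> in the condition on \<open>v\<close> accounts for the linear part of the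
  exponent \<open>3 k^2 - 3 k\<close> in \<open>cubic_fps\<close>.\<close>

lemma H_series_linear:
  assumes q: "q \<noteq> 0" and u: "u = q powi cu" and e: "e = q powi ce" and v: "v ^ 3 / q ^ 3 = q powi ck"
  shows "H_series (\<lambda>i j k. cu * int i + ce * int j + ck * int k) 1 q =
     (\<Sum>\<^sub>\<infinity>(j, i, m). q ^ (2 * j + i + m)\<^sup>2 / q ^ (2 * j + i + m) *
            (e ^ j / qpoch (q ^ 4) (q ^ 4) (enat j)) * (qexp u q $ i * cubic_fps v q $ m))"
    (is "_ = infsum ?F UNIV")
proof -
  have powi: "q powi ((int i + 2 * int j + 3 * int k) * (int i + 2 * int j + 3 * int k - 1)
        + 3 * (int k)\<^sup>2 + (cu * int i + ce * int j + ck * int k))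
      = q ^ (2 * j + i + 3 * k)\<^sup>2 / q ^ (2 * j + i + 3 * k) * q ^ (3 * k\<^sup>2) * u ^ i * e ^ j * (v ^ 3 / q ^ 3) ^ k" for i j k
  proof -
    have "(int i + 2 * int j + 3 * int k) * (int i + 2 * int j + 3 * int k - 1)
        + 3 * (int k)\<^sup>2 + (cu * int i + ce * int j + ck * int k)
        = int ((2 * j + i + 3 * k)\<^sup>2) - int (2 * j + i + 3 * k) + int (3 * k\<^sup>2) + cu * int i + ce * int j + ck * int k"
      by (simp add: power2_eq_square algebra_simps)
    then show ?thesis
      using q by (simp only: power_int_add power_int_diff power_int_mult power_int_of_nat u e v simp_thms)
  qed
  have "H_series (\<lambda>i j k. cu * int i + ce * int j + ck * int k) 1 q = infsum ?F {(j, i, m). 3 dvd m}"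
    unfolding H_series_def powi
  proof (rule infsum_reindex_bij_witness[of _ "\<lambda>(j, i, m). (i, j, m div 3)" "\<lambda>(i, j, k). (j, i, 3 * k)"])
    fix z :: "nat \<times> nat \<times> nat"
    obtain i j k where z: "z = (i, j, k)" by (cases z) auto
    have "v ^ (3 * k) = (v ^ 3) ^ k" "q ^ (3 * k) = (q ^ 3) ^ k" by (simp_all only: power_mult)
    then show "?F (case z of (i, j, k) \<Rightarrow> (j, i, 3 * k)) =
       (case z of (i, j, k) \<Rightarrow> (-1) ^ k * (q ^ (2 * j + i + 3 * k)\<^sup>2 / q ^ (2 * j + i + 3 * k) * q ^ (3 * k\<^sup>2) * u ^ i * e ^ j * (v ^ 3 / q ^ 3) ^ k /
           (qpoch q q (enat i) * qpoch (q ^ 4) (q ^ 4) (enat j) * qpoch (q ^ 6) (q ^ 6) (enat k))) * 1 ^ (i + 2 * j + 3 * k))"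
      unfolding z prod.case cubic_fps_nth_3 by (simp add: power_divide mult_ac)
  qed (auto simp: dvd_def)
  also have "\<dots> = infsum ?F UNIV"
    by (rule infsum_cong_neutral) (auto simp: cubic_fps_nth_eq_0)
  finally show ?thesis .
qed

text \<open>Dividing by the nonzero \<open>K\<close> gives summability of \<open>f\<close>, without
  which \<open>suminf f\<close> would carry no information.\<close>

lemma sums_mult_const_imp_eq:
  fixes K S :: "'a :: real_normed_field"
  assumes "(\<lambda>n. K * f n) sums S" "K \<noteq> 0"
  shows "S = K * suminf f"
  using suminf_mult[OF summable_mult_D[OF sums_summable[OF assms(1)] assms(2)], of K] sums_unique[OF assms(1)]
  by simp

section \<open>Single-sum evaluations in the cases \<open>a t^2 = e\<close> and
  \<open>a t^2 = e q^2\<close>\<close>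

context
  fixes q t a u v e :: complex and cu ce ck :: int and \<sigma> :: nat and c :: "nat \<Rightarrow> complex"
  assumes q: "q \<noteq> 0" "norm q < 1" and t: "\<And>i. t * (q\<^sup>2) ^ i \<noteq> 1"
    and uv: "{u, u * q} = {a, v}" and v: "a * t = v" and e: "a * t\<^sup>2 = e * (q\<^sup>2) ^ \<sigma>" and \<sigma>: "\<sigma> \<le> 1"
    and cu: "u = q powi cu" and ce: "e = q powi ce" and ck: "v ^ 3 / q ^ 3 = q powi ck"
  defines "c \<equiv> \<lambda>n. a ^ n * qpoch (t ^ 3) (q ^ 6) (enat n) / (qpoch t (q\<^sup>2) (enat n) * qpoch (q\<^sup>2) (q\<^sup>2) (enat n))"
begin

private lemma q_powers: "norm (q\<^sup>2) < 1" "norm (q ^ 4) < 1" "norm (q ^ 6) < 1"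
  using q by (simp_all add: norm_power power_less_one_iff)

text \<open>With \<open>x = (q\<^sup>2) ^ n\<close>, the new numerator factor
  \<open>1 - t^3 x^3\<close> is divisible by the new denominator factor \<open>1 - t x\<close>,
  which leaves the quadratic. This is the recursion required of \<open>rho\<close> for
  \<open>v = a t\<close> and \<open>w = a t^2\<close>.\<close>

private lemma c_Suc: "c (Suc n) * (1 - q\<^sup>2 * (q\<^sup>2) ^ n) = c n * (a * (1 + t * (q\<^sup>2) ^ n + t\<^sup>2 * ((q\<^sup>2) ^ n)\<^sup>2))"
proof -
  define x where "x = (q\<^sup>2) ^ n"
  have x3: "(q ^ 6) ^ n = x ^ 3" by (simp add: x_def flip: power_mult)
  have "qpoch t (q\<^sup>2) (enat n) \<noteq> 0" "qpoch (q\<^sup>2) (q\<^sup>2) (enat n) \<noteq> 0" "1 - t * x \<noteq> 0" "1 - q\<^sup>2 * x \<noteq> 0"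
    using qpoch_nonzero[OF t] qpoch_self_nonzero[OF q_powers(1)] t[of n]
      power_neq_1[OF q_powers(1), of "Suc n"] by (auto simp: x_def)
  moreover have "1 - t ^ 3 * x ^ 3 = (1 + t * x + t\<^sup>2 * x\<^sup>2) * (1 - t * x)"
    by (simp add: power2_eq_square power3_eq_cube algebra_simps)
  ultimately show ?thesis
    unfolding c_def qpoch_Suc x3 x_def[symmetric] by (simp add: divide_simps)
qed

text \<open>This is \<open>cubic_series_transform\<close> with \<open>c\<close> as
  \<open>rho\<close>. The $q$-shifted factorials in \<open>c\<close> and the reciprocals of those in
  its denominator are bounded, so \<open>c\<close> grows at most like
  \<open>norm a ^ n\<close>.\<close>

private lemma H_series_sums:
  "(\<lambda>n. c n * (q ^ n\<^sup>2 / q ^ n) * qpoch (e * (q ^ 4) ^ n * (q ^ 4) ^ \<sigma>) (q ^ 4) \<infinity>)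
     sums H_series (\<lambda>i j k. cu * int i + ce * int j + ck * int k) 1 q"
proof -
  obtain B1 where B1: "B1 > 0" "\<And>n. norm (qpoch (t ^ 3) (q ^ 6) (enat n)) \<le> B1"
    using qpoch_bounded[OF q_powers(3)] by blast
  obtain B2 where B2: "B2 > 0" "\<And>n. norm (1 / qpoch t (q\<^sup>2) (enat n)) \<le> B2"
    using inverse_qpoch_bounded[OF q_powers(1) t] by blast
  obtain B3 where B3: "B3 > 0" "\<And>n. norm (1 / qpoch (q\<^sup>2) (q\<^sup>2) (enat n)) \<le> B3"
    using inverse_qpoch_self_bounded[OF q_powers(1)] by blast
  have c_le: "norm (c n) \<le> (B1 * (B2 * B3)) * norm a ^ n" for n
  proof -
    have "norm (c n) = norm (qpoch (t ^ 3) (q ^ 6) (enat n)) *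
        (norm (1 / qpoch t (q\<^sup>2) (enat n)) * norm (1 / qpoch (q\<^sup>2) (q\<^sup>2) (enat n))) * norm a ^ n"
      by (simp add: c_def norm_mult norm_divide norm_power)
    also have "\<dots> \<le> (B1 * (B2 * B3)) * norm a ^ n"
      using B1(1) B2(1) B3(1) by (intro mult_right_mono mult_mono B1 B2 B3) auto
    finally show ?thesis .
  qed
  have aw: "a * (a * t\<^sup>2) = v\<^sup>2" by (simp add: v[symmetric] power2_eq_square)
  have rec: "c (Suc n) * (1 - q\<^sup>2 * (q\<^sup>2) ^ n) = c n * (a + v * (q\<^sup>2) ^ n + (a * t\<^sup>2) * (q\<^sup>2) ^ (2 * n))" for n
    unfolding c_Suc v[symmetric] by (simp add: power_mult power2_eq_square power_mult_distrib algebra_simps)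
  note main = cubic_series_transform[OF q uv aw e \<sigma> _ rec _ _ c_le]
  show ?thesis
    unfolding H_series_linear[OF q(1) cu ce ck]
    using main B1 B2 B3 by (intro has_sum_imp_sums) (auto simp: has_sum_infsum c_def)
qed

text \<open>For \<open>\<sigma> = 0\<close> the infinite product in the \<open>n\<close>-th term is
  the one at \<open>e\<close> divided by its first \<open>n\<close> factors, so
  \<open>qpoch e (q ^ 4) \<infinity>\<close> can be taken out of the sum.\<close>

lemma H_series_balanced:
  assumes "\<sigma> = 0" and e_nz: "\<And>i. e * (q ^ 4) ^ i \<noteq> 1"
  shows "H_series (\<lambda>i j k. cu * int i + ce * int j + ck * int k) 1 q = qpoch e (q ^ 4) \<infinity> *
     (\<Sum>n. qpoch (t ^ 3) (q ^ 6) (enat n) * (a ^ n * (q ^ n\<^sup>2 / q ^ n)) /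
         (qpochs [t, q\<^sup>2] (q\<^sup>2) (enat n) * qpoch e (q ^ 4) (enat n)))"
proof -
  have nz: "qpoch e (q ^ 4) (enat n) \<noteq> 0" for n using qpoch_nonzero[OF e_nz] .
  have "c n * (q ^ n\<^sup>2 / q ^ n) * qpoch (e * (q ^ 4) ^ n * (q ^ 4) ^ \<sigma>) (q ^ 4) \<infinity> =
     qpoch e (q ^ 4) \<infinity> * (qpoch (t ^ 3) (q ^ 6) (enat n) * (a ^ n * (q ^ n\<^sup>2 / q ^ n)) /
         (qpochs [t, q\<^sup>2] (q\<^sup>2) (enat n) * qpoch e (q ^ 4) (enat n)))" for n
    using qpoch_inf_split[OF q_powers(2), of e n] nz[of n] assms(1) by (simp add: qpochs_def c_def mult_ac)
  then have "(\<lambda>n. qpoch e (q ^ 4) \<infinity> * (qpoch (t ^ 3) (q ^ 6) (enat n) * (a ^ n * (q ^ n\<^sup>2 / q ^ n)) /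
         (qpochs [t, q\<^sup>2] (q\<^sup>2) (enat n) * qpoch e (q ^ 4) (enat n))))
       sums H_series (\<lambda>i j k. cu * int i + ce * int j + ck * int k) 1 q"
    using H_series_sums by simp
  then show ?thesis by (rule sums_mult_const_imp_eq[OF _ qpoch_inf_nonzero[OF q_powers(2) e_nz]])
qed

text \<open>Here the terms of the series are \<open>c n * W n * X (Suc n)\<close>. Adding the
  telescoping difference of \<open>c n * W n * X n\<close>, whose total is \<open>- X 0\<close>,
  changes the sum by \<open>- qpoch e (q ^ 4) \<infinity>\<close> and brings the terms into the
  stated form.\<close>

lemma H_series_contiguous:
  assumes "\<sigma> = 1" and e_nz: "\<And>i. e * q ^ 4 * (q ^ 4) ^ i \<noteq> 1" and a: "a \<noteq> 0"
  shows "H_series (\<lambda>i j k. cu * int i + ce * int j + ck * int k) 1 q = qpoch e (q ^ 4) \<infinity> + qpoch (e * q ^ 4) (q ^ 4) \<infinity> *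
     (\<Sum>n. (1 + e / a * (q\<^sup>2) ^ n + t * (q\<^sup>2) ^ n) * qpoch (t ^ 3) (q ^ 6) (enat n) * (a ^ Suc n * (q ^ n\<^sup>2 * q ^ n)) /
         ((1 - q ^ (2 * n + 2)) * qpochs [t, q\<^sup>2] (q\<^sup>2) (enat n) * qpoch (e * q ^ 4) (q ^ 4) (enat n)))"
proof -
  have nz: "qpoch (e * q ^ 4) (q ^ 4) (enat n) \<noteq> 0" for n using qpoch_nonzero[OF e_nz] .
  let ?H = "H_series (\<lambda>i j k. cu * int i + ce * int j + ck * int k) 1 q"
  define X where "X = (\<lambda>n. qpoch (e * (q ^ 4) ^ n) (q ^ 4) \<infinity>)"
  define W where "W = (\<lambda>n. q ^ n\<^sup>2 / q ^ n)"
  define Y where "Y = (\<lambda>n. (1 + e / a * (q\<^sup>2) ^ n + t * (q\<^sup>2) ^ n) * qpoch (t ^ 3) (q ^ 6) (enat n) * (a ^ Suc n * (q ^ n\<^sup>2 * q ^ n)) /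
         ((1 - q ^ (2 * n + 2)) * qpochs [t, q\<^sup>2] (q\<^sup>2) (enat n) * qpoch (e * q ^ 4) (q ^ 4) (enat n)))"
  have X_Suc: "X n = (1 - e * (q ^ 4) ^ n) * X (Suc n)" for n
    using qpoch_inf_split[OF q_powers(2), of "e * (q ^ 4) ^ n" 1] by (simp add: X_def qpoch_enat mult_ac)
  have T: "(\<lambda>n. c n * W n * X (Suc n)) sums ?H"
    using H_series_sums unfolding assms(1) by (simp add: X_def W_def mult_ac)
  \<comment> \<open>The telescoping terms differ from the terms of the convergent series
    \<open>T\<close> only by a factor tending to 1.\<close>
  have S0: "(\<lambda>n. c n * W n * X n) \<longlonglongrightarrow> 0"
  proof -
    have "(\<lambda>n. (1 - e * (q ^ 4) ^ n) * (c n * W n * X (Suc n))) \<longlonglongrightarrow> (1 - e * 0) * 0"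
      by (intro tendsto_intros LIMSEQ_power_zero q_powers summable_LIMSEQ_zero sums_summable[OF T])
    moreover have "(1 - e * (q ^ 4) ^ n) * (c n * W n * X (Suc n)) = c n * W n * X n" for n
      unfolding X_Suc[of n] by (simp only: mult_ac)
    ultimately show ?thesis by simp
  qed
  have "(\<lambda>n. c n * W n * X (Suc n) + (c (Suc n) * W (Suc n) * X (Suc n) - c n * W n * X n)) sums
     (?H + (0 - c 0 * W 0 * X 0))"
    by (intro sums_add T telescope_sums S0)
  moreover have "c n * W n * X (Suc n) + (c (Suc n) * W (Suc n) * X (Suc n) - c n * W n * X n)
     = qpoch (e * q ^ 4) (q ^ 4) \<infinity> *
       Y n" (is "?l = ?r") for n
  proof -
    define x where "x = (q\<^sup>2) ^ n"
    have x2: "(q ^ 4) ^ n = x\<^sup>2" "q ^ (2 * n + 2) = q\<^sup>2 * x" by (simp_all add: x_def flip: power_mult power_add)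
    have x': "q ^ n * q ^ n = x" by (simp add: x_def power2_eq_square power_mult_distrib)
    have d: "1 - q\<^sup>2 * x \<noteq> 0"
      using power_neq_1[OF q_powers(1), of "Suc n"] by (auto simp: x_def)
    have W_Suc: "W (Suc n) = W n * x"
      using q by (simp add: W_def x_def field_simps power2_eq_square power_add power_mult_distrib)
    have cS: "c (Suc n) = c n * (a * (1 + t * x + t\<^sup>2 * x\<^sup>2)) / (1 - q\<^sup>2 * x)"
      using c_Suc[of n] d by (simp add: x_def field_simps)
    have Xn: "X (Suc n) = qpoch (e * q ^ 4) (q ^ 4) \<infinity> / qpoch (e * q ^ 4) (q ^ 4) (enat n)"
      using qpoch_inf_split[OF q_powers(2), of "e * q ^ 4" n] nz[of n] by (simp add: X_def mult_ac)
    have "?l = X (Suc n) * W n * (c (Suc n) * x + c n * (e * x\<^sup>2))"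
      unfolding X_Suc[of n] W_Suc x2 by (simp add: algebra_simps)
    also have "c (Suc n) * x + c n * (e * x\<^sup>2) = c n * (a * x * (1 + t * x + t\<^sup>2 * x\<^sup>2) + e * x\<^sup>2 * (1 - q\<^sup>2 * x)) / (1 - q\<^sup>2 * x)"
      unfolding cS using d by (simp add: field_simps)
    \<comment> \<open>The cubic coefficient \<open>a t^2 - e q^2\<close> is isolated because it
      vanishes by the assumption on \<open>e\<close> for \<open>\<sigma> = 1\<close>.\<close>
    also have "a * x * (1 + t * x + t\<^sup>2 * x\<^sup>2) + e * x\<^sup>2 * (1 - q\<^sup>2 * x) = a * x * (1 + e / a * x + t * x) + x ^ 3 * (a * t\<^sup>2 - e * (q\<^sup>2) ^ \<sigma>)"
      using a by (simp add: assms(1) field_simps power2_eq_square power3_eq_cube)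
    also have "\<dots> = a * x * (1 + e / a * x + t * x)" using e by simp
    finally have l: "?l = X (Suc n) * W n * (c n * (a * x * (1 + e / a * x + t * x)) / (1 - q\<^sup>2 * x))" .
    have Wx: "W n * x = q ^ n\<^sup>2 * q ^ n" using q by (simp add: W_def flip: x')
    have "?l = X (Suc n) * ((W n * x) * (c n * (a * (1 + e / a * x + t * x)) / (1 - q\<^sup>2 * x)))"
      unfolding l by simp
    also have "\<dots> = ?r"
      unfolding Wx Xn x2 c_def Y_def x_def[symmetric] by (simp add: x2 qpochs_def mult_ac)
    finally show ?thesis .
  qed
  ultimately have "(\<lambda>n. qpoch (e * q ^ 4) (q ^ 4) \<infinity> * Y n) sums (?H - qpoch e (q ^ 4) \<infinity>)"
    by (simp add: c_def W_def X_def)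
  then have "?H - qpoch e (q ^ 4) \<infinity> = qpoch (e * q ^ 4) (q ^ 4) \<infinity> * suminf Y"
    by (rule sums_mult_const_imp_eq[OF _ qpoch_inf_nonzero[OF q_powers(2) e_nz]])
  then show ?thesis unfolding Y_def by (simp only: diff_eq_eq add.commute)
qed

end

section \<open>Specialization to the four series\<close>

theorem theorem1p2:
  fixes q :: complex
  assumes "0 < norm q" and "norm q < 1"
  shows "H4 1 q =
           qpoch (q ^ 3) (q ^ 4) \<infinity> *
           (\<Sum>n. qpoch (q ^ 3) (q ^ 6) (enat n) * q ^ (n\<^sup>2)
                 / (qpochs [q, q ^ 2] (q ^ 2) (enat n) * qpoch (q ^ 3) (q ^ 4) (enat n)))
  \<and> H5 1 q =
           qpoch (q powi (-1)) (q ^ 4) \<infinity> +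
           qpoch (q ^ 3) (q ^ 4) \<infinity> *
           (\<Sum>n. (1 + q powi (2 * int n - 4) + q powi (2 * int n - 1))
                 * qpoch (q powi (-3)) (q ^ 6) (enat n) * q ^ (n\<^sup>2 + 4 * n + 3)
                 / ((1 - q ^ (2 * n + 2)) * qpochs [q powi (-1), q ^ 2] (q ^ 2) (enat n)
                    * qpoch (q ^ 3) (q ^ 4) (enat n)))
  \<and> H8 1 q =
           qpoch q (q ^ 4) \<infinity> +
           qpoch (q ^ 5) (q ^ 4) \<infinity> *
           (\<Sum>n. (1 + q ^ (2 * n) + q ^ (2 * n + 1))
                 * qpoch (q ^ 3) (q ^ 6) (enat n) * q ^ (n\<^sup>2 + 2 * n + 1)
                 / ((1 - q ^ (2 * n + 2)) * qpochs [q, q ^ 2] (q ^ 2) (enat n)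
                    * qpoch (q ^ 5) (q ^ 4) (enat n)))
  \<and> H9 1 q =
           qpoch (q ^ 5) (q ^ 4) \<infinity> *
           (\<Sum>n. qpoch (q ^ 3) (q ^ 6) (enat n) * q ^ (n\<^sup>2 + 2 * n)
                 / (qpochs [q, q ^ 2] (q ^ 2) (enat n) * qpoch (q ^ 5) (q ^ 4) (enat n)))"
proof (intro conjI)
  have q: "q \<noteq> 0" "norm q < 1" using assms by auto
  have t: "q * (q\<^sup>2) ^ i \<noteq> 1" for i
    using power_neq_1[OF q(2), of "2 * i + 1"] by (simp add: power_mult)
  have t': "inverse q * (q\<^sup>2) ^ i \<noteq> 1" for i
  proof (cases i)
    case 0
    then show ?thesis using power_neq_1[OF q(2), of 1] by auto
  next
    case (Suc l)
    have "inverse q * (q\<^sup>2) ^ i = (inverse q * q) * (q * (q\<^sup>2) ^ l)"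
      unfolding Suc power_Suc power2_eq_square by (simp only: mult_ac)
    then show ?thesis using t[of l] q by simp
  qed
  have e: "q ^ Suc m * (q ^ 4) ^ i \<noteq> 1" for m i
    using power_neq_1[OF q(2), of "Suc m + 4 * i"] by (simp only: power_add power_mult) simp
  have pow: "(q ^ m) ^ n = (q ^ n) ^ m" for m n by (simp flip: power_mult add: mult.commute)
  \<comment> \<open>The parameters are read off from the exponent: the coefficients of
    \<open>i\<close> and \<open>j\<close> give \<open>u\<close> and \<open>e\<close>, and that of
    \<open>k\<close> gives \<open>v ^ 3 / q ^ 3\<close>. Then \<open>a\<close> is the other element
    of \<open>{u, u * q}\<close>, and \<open>t = v / a\<close>. Unit coefficients are written out to
    match the linear form.\<close>
  have H4: "H4 1 q = H_series (\<lambda>i j k. 1 * int i + 3 * int j + 3 * int k) 1 q"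
    by (simp add: H4_def)
  have "H4 1 q = qpoch (q ^ 3) (q ^ 4) \<infinity> *
     (\<Sum>n. qpoch (q ^ 3) (q ^ 6) (enat n) * (q ^ n * (q ^ n\<^sup>2 / q ^ n)) /
         (qpochs [q, q\<^sup>2] (q\<^sup>2) (enat n) * qpoch (q ^ 3) (q ^ 4) (enat n)))"
    unfolding H4
  \<comment> \<open>Parameters: \<open>u = a = t = q\<close>, \<open>v = q^2\<close>,
    \<open>e = q^3\<close>.\<close>
  proof (rule H_series_balanced[OF q t])
    show "{q, q * q} = {q, q\<^sup>2}" by (simp add: power2_eq_square)
    show "q * q = q\<^sup>2" by (simp add: power2_eq_square)
    show "q * q\<^sup>2 = q ^ 3 * (q\<^sup>2) ^ 0" by (simp add: power2_eq_square power3_eq_cube)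
    show "q = q powi 1" "q ^ 3 = q powi 3" by simp_all
    show "(q\<^sup>2) ^ 3 / q ^ 3 = q powi 3" using q by (simp flip: power_mult power_diff)
    show "q ^ 3 * (q ^ 4) ^ i \<noteq> 1" for i using e[of 2 i] by simp
  qed simp_all
  then show "H4 1 q =
           qpoch (q ^ 3) (q ^ 4) \<infinity> *
           (\<Sum>n. qpoch (q ^ 3) (q ^ 6) (enat n) * q ^ (n\<^sup>2)
                 / (qpochs [q, q ^ 2] (q ^ 2) (enat n) * qpoch (q ^ 3) (q ^ 4) (enat n)))"
    using q by simp
  have H9: "H9 1 q = H_series (\<lambda>i j k. 3 * int i + 5 * int j + 9 * int k) 1 q"
    by (simp add: H9_def)
  have "H9 1 q = qpoch (q ^ 5) (q ^ 4) \<infinity> *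
     (\<Sum>n. qpoch (q ^ 3) (q ^ 6) (enat n) * ((q ^ 3) ^ n * (q ^ n\<^sup>2 / q ^ n)) /
         (qpochs [q, q\<^sup>2] (q\<^sup>2) (enat n) * qpoch (q ^ 5) (q ^ 4) (enat n)))"
    unfolding H9
  \<comment> \<open>Parameters: \<open>u = a = q^3\<close>, \<open>t = q\<close>,
    \<open>v = q^4\<close>, \<open>e = q^5\<close>.\<close>
  proof (rule H_series_balanced[OF q t])
    show "{q ^ 3, q ^ 3 * q} = {q ^ 3, q ^ 4}" by (simp flip: power_Suc2)
    show "q ^ 3 * q = q ^ 4" by (simp flip: power_Suc2)
    show "q ^ 3 * q\<^sup>2 = q ^ 5 * (q\<^sup>2) ^ 0" by (simp flip: power_add)
    show "q ^ 3 = q powi 3" "q ^ 5 = q powi 5" by simp_all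
    show "(q ^ 4) ^ 3 / q ^ 3 = q powi 9" using q by (simp flip: power_mult power_diff)
    show "q ^ 5 * (q ^ 4) ^ i \<noteq> 1" for i using e[of 4 i] by simp
  qed simp_all
  moreover have "(q ^ 3) ^ n * (q ^ n\<^sup>2 / q ^ n) = q ^ (n\<^sup>2 + 2 * n)" for n
    unfolding pow[of 3] power_add power_mult pow[of 2]
    using q by (simp add: power3_eq_cube power2_eq_square[of "q ^ n"])
  ultimately show "H9 1 q =
           qpoch (q ^ 5) (q ^ 4) \<infinity> *
           (\<Sum>n. qpoch (q ^ 3) (q ^ 6) (enat n) * q ^ (n\<^sup>2 + 2 * n)
                 / (qpochs [q, q ^ 2] (q ^ 2) (enat n) * qpoch (q ^ 5) (q ^ 4) (enat n)))"
    by (simp only:)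
  have H8: "H8 1 q = H_series (\<lambda>i j k. 1 * int i + 1 * int j + 3 * int k) 1 q"
    by (simp add: H8_def)
  have "H8 1 q = qpoch q (q ^ 4) \<infinity> + qpoch (q * q ^ 4) (q ^ 4) \<infinity> *
     (\<Sum>n. (1 + q / q * (q\<^sup>2) ^ n + q * (q\<^sup>2) ^ n) * qpoch (q ^ 3) (q ^ 6) (enat n) * (q ^ Suc n * (q ^ n\<^sup>2 * q ^ n)) /
         ((1 - q ^ (2 * n + 2)) * qpochs [q, q\<^sup>2] (q\<^sup>2) (enat n) * qpoch (q * q ^ 4) (q ^ 4) (enat n)))"
    unfolding H8
  \<comment> \<open>Parameters: \<open>u = a = t = e = q\<close>, \<open>v = q^2\<close>; now
    \<open>a t^2\<close> is \<open>e q^2\<close>.\<close>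
  proof (rule H_series_contiguous[OF q t])
    show "{q, q * q} = {q, q\<^sup>2}" by (simp add: power2_eq_square)
    show "q * q = q\<^sup>2" by (simp add: power2_eq_square)
    show "q * q\<^sup>2 = q * (q\<^sup>2) ^ 1" by simp
    show "q = q powi 1" by simp
    show "q = q powi 1" by simp
    show "(q\<^sup>2) ^ 3 / q ^ 3 = q powi 3" using q by (simp flip: power_mult power_diff)
    show "q * q ^ 4 * (q ^ 4) ^ i \<noteq> 1" for i using e[of 4 i] unfolding power_Suc[of q 4] .
  qed (use q in simp_all)
  moreover have "q * q ^ 4 = q ^ 5" by (simp flip: power_Suc)
  moreover have "1 + q / q * (q\<^sup>2) ^ n + q * (q\<^sup>2) ^ n = 1 + q ^ (2 * n) + q ^ (2 * n + 1)"
     "q ^ Suc n * (q ^ n\<^sup>2 * q ^ n) = q ^ (n\<^sup>2 + 2 * n + 1)" for n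
    using q by (simp_all add: power_mult power_add pow[of 2] power2_eq_square[of "q ^ n"])
  ultimately show "H8 1 q =
           qpoch q (q ^ 4) \<infinity> +
           qpoch (q ^ 5) (q ^ 4) \<infinity> *
           (\<Sum>n. (1 + q ^ (2 * n) + q ^ (2 * n + 1))
                 * qpoch (q ^ 3) (q ^ 6) (enat n) * q ^ (n\<^sup>2 + 2 * n + 1)
                 / ((1 - q ^ (2 * n + 2)) * qpochs [q, q ^ 2] (q ^ 2) (enat n)
                    * qpoch (q ^ 5) (q ^ 4) (enat n)))"
    by (simp only:)
  have H5: "H5 1 q = H_series (\<lambda>i j k. 2 * int i + (-1) * int j + 3 * int k) 1 q"
    by (simp add: H5_def)
  have e5: "inverse q * q ^ 4 = q ^ 3" using q by (simp add: eval_nat_numeral)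
  have "H5 1 q = qpoch (inverse q) (q ^ 4) \<infinity> + qpoch (inverse q * q ^ 4) (q ^ 4) \<infinity> *
     (\<Sum>n. (1 + inverse q / q ^ 3 * (q\<^sup>2) ^ n + inverse q * (q\<^sup>2) ^ n) * qpoch (inverse q ^ 3) (q ^ 6) (enat n)
            * ((q ^ 3) ^ Suc n * (q ^ n\<^sup>2 * q ^ n)) /
         ((1 - q ^ (2 * n + 2)) * qpochs [inverse q, q\<^sup>2] (q\<^sup>2) (enat n) * qpoch (inverse q * q ^ 4) (q ^ 4) (enat n)))"
    unfolding H5
  \<comment> \<open>Parameters: \<open>u = v = q^2\<close>, \<open>a = q^3\<close>,
    \<open>t = e = inverse q\<close>. This is the one case in which \<open>v\<close> is
    \<open>u\<close> and \<open>a\<close> is \<open>u * q\<close>, so that \<open>t\<close> is a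
    negative power of \<open>q\<close>.\<close>
  proof (rule H_series_contiguous[OF q t'])
    show "{q\<^sup>2, q\<^sup>2 * q} = {q ^ 3, q\<^sup>2}" by (simp add: insert_commute flip: power_Suc2)
    show "q ^ 3 * inverse q = q\<^sup>2" using q by (simp add: power2_eq_square power3_eq_cube)
    show "q ^ 3 * (inverse q)\<^sup>2 = inverse q * (q\<^sup>2) ^ 1"
      using q by (simp add: field_simps power2_eq_square power3_eq_cube)
    show "q\<^sup>2 = q powi 2" "inverse q = q powi - 1" by (simp_all add: power_int_minus)
    show "(q\<^sup>2) ^ 3 / q ^ 3 = q powi 3" using q by (simp flip: power_mult power_diff)
    show "inverse q * q ^ 4 * (q ^ 4) ^ i \<noteq> 1" for i
      using e[of 2 i] unfolding e5 by simp
  qed (use q in simp_all)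
  moreover note e5
  moreover have "1 + inverse q / q ^ 3 * (q\<^sup>2) ^ n + inverse q * (q\<^sup>2) ^ n
        = 1 + q powi (2 * int n - 4) + q powi (2 * int n - 1)" for n
  proof -
    have "q powi (2 * int n) = (q\<^sup>2) ^ n" by (simp add: power_int_mult)
    then show ?thesis using q by (simp add: power_int_diff divide_simps eval_nat_numeral)
  qed
  moreover have "(q ^ 3) ^ Suc n * (q ^ n\<^sup>2 * q ^ n) = q ^ (n\<^sup>2 + 4 * n + 3)" for n
    by (simp flip: power_mult power_add) (simp add: algebra_simps)
  moreover have "inverse q = q powi (-1)" "inverse q ^ 3 = q powi (-3)"
    by (simp_all add: power_int_minus power_inverse)
  ultimately show "H5 1 q =
           qpoch (q powi (-1)) (q ^ 4) \<infinity> +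
           qpoch (q ^ 3) (q ^ 4) \<infinity> *
           (\<Sum>n. (1 + q powi (2 * int n - 4) + q powi (2 * int n - 1))
                 * qpoch (q powi (-3)) (q ^ 6) (enat n) * q ^ (n\<^sup>2 + 4 * n + 3)
                 / ((1 - q ^ (2 * n + 2)) * qpochs [q powi (-1), q ^ 2] (q ^ 2) (enat n)
                    * qpoch (q ^ 3) (q ^ 4) (enat n)))"
    by (simp only:)
qed

end
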